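(* Let $G$ be the Markov graph of an irreducible network without degradation, with $\lambda^*>0$, satisfying the $\sigma^*$-dominant Hypothesis (there exists a dominant cycle through $\sigma^*$, and all dominant cycles pass through $\sigma^*$). Let $\alpha_{thr}$ be the estimate of $\lambda^*$ given by $\alpha_{thr}=\delta c_{high}/c'_{high}$ in a scale window containing it, the rates being away from the transition regime, so that $\alpha_{thr}\simeq\lambda^*$. Let $v^*$ be the Lyapunov eigenvector and let $\pi^*_\sigma=(|A_{\sigma,\sigma}|+\lambda^* )v^*_\sigma$ be the Lyapunov weights, normalized so that $\pi^*$ is a probability measure on $V$. Let $\gamma^*_{\sigma^*}$ be a dominant simple excursion from $\sigma^*$ to $\sigma^*$ with $w(\lambda^* )_{\gamma^*_{\sigma^*}}\simeq1$, and for $\sigma\neq\sigma^*$ let $\gamma^*_\sigma$ be a leading simple excursion from $\sigma^*$ to $\sigma$ with $f(\lambda^* )_{\sigma^*\to\sigma}\simeq w(\lambda^* )_{\gamma^*_\sigma}$. Then $$\pi^*_\sigma\simeq w(\alpha_{thr})_{\gamma^*_\sigma}\qquad\text{for all }\sigma\in V .$$ In particular, $\pi^*_{\sigma^*}\simeq1$.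
   Context: Network and generator. $V$ is a finite set of species, $R$ a finite set of reactions; each $\rho\in R$ has one reactant, a rate $k_\rho>0$, and $p(\rho)\in\{1,2\}$ products (with multiplicity), all different from the reactant (no degradation). A reaction with reactant $\sigma$ and rate $k_\rho$ contributes $-k_\rho$ to $A_{\sigma,\sigma}$ and $s\,k_\rho$ to $A_{\sigma',\sigma}$ for each product $\sigma'$ of multiplicity $s$. $\lambda^*$ is the (real) eigenvalue of $A$ with largest real part. Write $k_{\sigma\to\sigma'}=A_{\sigma',\sigma}$ ($\sigma\ne\sigma'$), $k_\sigma=\sum_{\sigma'\neq\sigma}k_{\sigma\to\sigma'}$, $a_\sigma=|A_{\sigma,\sigma}|$, $\kappa_\sigma=\sum_{\sigma'}A_{\sigma',\sigma}$, $\varepsilon_\sigma=\kappa_\sigma/a_\sigma$. The Markov graph $G=(V,E)$ has an edge $\sigma\to\sigma'$ iff $k_{\sigma\to\sigma'}>0$; it is assumed strongly connected (irreducibility), $|V|\ge2$. Then the $\lambda^*$-eigenspace of $A$ is spanned by a vector $v^*$ with positive entries, the Lyapunov eigenvector (unique up to normalization). Asymptotic conventions (separation of scales). The network is fixed and its rates depend on a base $b>1$: $k_\rho=c_\rho b^{n_\rho}$ with fixed integers $n_\rho$ and fixed constants $c_\rho\ge1$; $b\to\infty$. For positive quantities depending on $b$: $x\simeq y$ means that there is $C\ge1$ independent of $b$ with $C^{-1}y\le x\le Cy$ for all large $b$; $x\prec y$ means $x/y\to0$ as $b\to\infty$. Scales. $n_{\sigma\to\sigma'}=\lfloor\log_b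 k_{\sigma\to\sigma'}\rfloor$; $n_\sigma=\max_{\sigma'}n_{\sigma\to\sigma'}$ (fixed integers for large $b$). An edge $\sigma\to\sigma'$ is dominant if $n_{\sigma\to\sigma'}=n_\sigma$; a path or cycle is dominant if all its edges are dominant. The depth of a path $\gamma:\sigma_1\to\cdots\to\sigma_\ell$ is $D_\gamma=\sum_{i=1}^{\ell-1}(n_{\sigma_i}-n_{\sigma_i\to\sigma_{i+1}})\ge0$. Weights and excursions. For $\alpha\ge0$, $w(\alpha)_{\sigma\to\sigma'}=\dfrac{k_{\sigma\to\sigma'}}{a_\sigma+\alpha}$ and $\tilde w(0)_{\sigma\to\sigma'}=\dfrac{k_{\sigma\to\sigma'}}{k_\sigma}$; the weight of a path is the product of the weights of its edges. An excursion from $\sigma^*$ to $\sigma$ is a path $\sigma^*=\sigma_1\to\cdots\to\sigma_\ell=\sigma$, $\ell\ge2$, with $\sigma_2,\dots,\sigma_{\ell-1}\neq\sigma^*$; it is simple if it contains no inner loop (all vertices distinct, except $\sigma_1=\sigma_\ell$ when $\sigma=\sigma^*$). $f(\alpha)_{\sigma^*\to\sigma}$ is the sum of $w(\alpha)_\gamma$ over all excursions $\gamma$ from $\sigma^*$ to $\sigma$. For $\sigma\ne\sigma^*$, an excursion from $\sigma^*$ to $\sigma$ is leading if it minimizes $D_\gamma$ among all paths from $\sigma^*$ to $\sigma$. For an excursion $\gamma$ from $\sigma^*$ to $\sigma^*$, $1+\varepsilon_\gamma:=\prod_{i=1}^{\ell-1}(1+\varepsilon_{\sigma_i})$. Threshold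 $\alpha_{thr}$. A scale window is given by two consecutive vertex scales $n<n'$ (no vertex scale strictly between them), or by $n=-\infty$ and $n'$ the smallest vertex scale. Relative to it, an excursion from $\sigma^*$ to $\sigma^*$ is high if all its vertices have scale $\ge n'$ and low otherwise. Put $\delta c_{high}=-1+\sum_{\gamma\ \mathrm{high}}(1+\varepsilon_\gamma)\tilde w(0)_\gamma$ and $c'_{high}=-\frac{d}{d\alpha}\big(\sum_{\gamma\ \mathrm{high}}w(\alpha)_\gamma\big)|_{\alpha=0}$, the sums being over excursions from $\sigma^*$ to $\sigma^*$. The window contains $\alpha_{thr}=\delta c_{high}/c'_{high}$ if $\alpha_{thr}>0$ and $b^n\prec\alpha_{thr}\prec b^{n'}$ (the lower condition being void if $n=-\infty$). With $S_{high}=\sum_{\gamma\ \mathrm{high}}\varepsilon_\gamma\tilde w(0)_\gamma$, $S_{low}=\sum_{\gamma\ \mathrm{low}}\tilde w(0)_\gamma$, the rates are away from the transition regime if $S_{low}\prec S_{high}$ (including $S_{low}=0$) or $S_{high}\prec S_{low}$. *)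

theory Defs
  imports "HOL-Analysis.Analysis" "HOL-Library.Multiset"
begin

definition asymp_sim :: "(real \<Rightarrow> real) \<Rightarrow> (real \<Rightarrow> real) \<Rightarrow> bool" (infix "\<simeq>" 50) where
  "x \<simeq> y \<longleftrightarrow> (\<exists>C\<ge>1. \<forall>\<^sub>F b in at_top. inverse C * y b \<le> x b \<and> x b \<le> C * y b)"

definition asymp_prec :: "(real \<Rightarrow> real) \<Rightarrow> (real \<Rightarrow> real) \<Rightarrow> bool" (infix "\<prec>" 50) where
  "x \<prec> y \<longleftrightarrow> (\<forall>\<^sub>F b in at_top. 0 < y b) \<and> ((\<lambda>b. x b / y b) \<longlongrightarrow> 0) at_top"

definition complex_eigenvalues :: "real ^ 'n ^ 'n \<Rightarrow> complex set" where
  "complex_eigenvalues M =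
     {z. \<exists>x. x \<noteq> 0 \<and> (\<chi> i j. complex_of_real (M $ i $ j)) *v x = z *s x}"

definition top_eigenvalue :: "real ^ 'n ^ 'n \<Rightarrow> real" where
  "top_eigenvalue M =
     (THE l. complex_of_real l \<in> complex_eigenvalues M \<and>
             (\<forall>z\<in>complex_eigenvalues M. Re z \<le> l))"

text \<open>The species are the elements of the finite type \<open>'v\<close>.  Reaction \<open>\<rho>\<close> has the rate
  \<open>rate_coeff \<rho> * b ^ rate_expo \<rho>\<close>, where \<open>b\<close> is the base.\<close>

record ('r, 'v) network =
  reactions :: "'r set"
  reactant :: "'r \<Rightarrow> 'v"
  products :: "'r \<Rightarrow> 'v multiset"
  rate_coeff :: "'r \<Rightarrow> real"
  rate_expo :: "'r \<Rightarrow> int"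

definition wf_network :: "('r, 'v::finite) network \<Rightarrow> bool" where
  "wf_network N \<longleftrightarrow> finite (reactions N) \<and>
     (\<forall>\<rho>\<in>reactions N. size (products N \<rho>) \<in> {1, 2} \<and> reactant N \<rho> \<notin># products N \<rho> \<and>
        1 \<le> rate_coeff N \<rho>)"

definition reaction_rate :: "('r, 'v::finite) network \<Rightarrow> real \<Rightarrow> 'r \<Rightarrow> real" where
  "reaction_rate N b \<rho> = rate_coeff N \<rho> * b powi rate_expo N \<rho>"

text \<open>Row index: species produced; column index: reactant.\<close>

definition generator :: "('r, 'v::finite) network \<Rightarrow> real \<Rightarrow> real ^ 'v ^ 'v" where
  "generator N b = (\<chi> i j. \<Sum>\<rho> | \<rho> \<in> reactions N \<and> reactant N \<rho> = j.
     (if i = j then - reaction_rate N b \<rho> else 0) +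
     real (count (products N \<rho>) i) * reaction_rate N b \<rho>)"

definition lyapunov_exponent :: "('r, 'v::finite) network \<Rightarrow> real \<Rightarrow> real" where
  "lyapunov_exponent N b = top_eigenvalue (generator N b)"

text \<open>\<open>trans_rate N b \<sigma> \<sigma>'\<close> is \<open>k\<^bsub>\<sigma>\<rightarrow>\<sigma>'\<^esub>\<close>; it is only meaningful, and only used, for \<open>\<sigma> \<noteq> \<sigma>'\<close>.\<close>

definition trans_rate :: "('r, 'v::finite) network \<Rightarrow> real \<Rightarrow> 'v \<Rightarrow> 'v \<Rightarrow> real" where
  "trans_rate N b \<sigma> \<sigma>' = generator N b $ \<sigma>' $ \<sigma>"

text \<open>In the usual notation, \<open>out_rate\<close> is \<open>k\<^sub>\<sigma>\<close>, \<open>diag_rate\<close> is \<open>a\<^sub>\<sigma>\<close>, \<open>growth_rate\<close> is \<open>\<kappa>\<^sub>\<sigma>\<close>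
  and \<open>rel_growth\<close> is \<open>\<epsilon>\<^sub>\<sigma>\<close>.\<close>

definition out_rate :: "('r, 'v::finite) network \<Rightarrow> real \<Rightarrow> 'v \<Rightarrow> real" where
  "out_rate N b \<sigma> = (\<Sum>\<sigma>'\<in>UNIV - {\<sigma>}. trans_rate N b \<sigma> \<sigma>')"

definition diag_rate :: "('r, 'v::finite) network \<Rightarrow> real \<Rightarrow> 'v \<Rightarrow> real" where
  "diag_rate N b \<sigma> = \<bar>generator N b $ \<sigma> $ \<sigma>\<bar>"

definition growth_rate :: "('r, 'v::finite) network \<Rightarrow> real \<Rightarrow> 'v \<Rightarrow> real" where
  "growth_rate N b \<sigma> = (\<Sum>\<sigma>'\<in>UNIV. generator N b $ \<sigma>' $ \<sigma>)"

definition rel_growth :: "('r, 'v::finite) network \<Rightarrow> real \<Rightarrow> 'v \<Rightarrow> real" where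
  "rel_growth N b \<sigma> = growth_rate N b \<sigma> / diag_rate N b \<sigma>"

text \<open>Whether \<open>k\<^bsub>\<sigma>\<rightarrow>\<sigma>'\<^esub> > 0\<close> does not depend on \<open>b\<close>; see \<open>edge_iff\<close> below.\<close>

definition edge :: "('r, 'v::finite) network \<Rightarrow> 'v \<Rightarrow> 'v \<Rightarrow> bool" where
  "edge N \<sigma> \<sigma>' \<longleftrightarrow> \<sigma> \<noteq> \<sigma>' \<and> (\<forall>b>1. 0 < trans_rate N b \<sigma> \<sigma>')"

definition strongly_connected :: "('r, 'v::finite) network \<Rightarrow> bool" where
  "strongly_connected N \<longleftrightarrow> (\<forall>\<sigma> \<sigma>'. (edge N)\<^sup>*\<^sup>* \<sigma> \<sigma>')"

definition is_path :: "('r, 'v::finite) network \<Rightarrow> 'v list \<Rightarrow> bool" where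
  "is_path N \<gamma> \<longleftrightarrow> \<gamma> \<noteq> [] \<and> successively (edge N) \<gamma>"

text \<open>Closed paths are not required to be simple.  For the dominance hypothesis below this makes
  no difference: a closed path contains a simple cycle, and one through \<open>s\<close> contains a simple
  cycle through \<open>s\<close>.\<close>

definition is_cycle :: "('r, 'v::finite) network \<Rightarrow> 'v list \<Rightarrow> bool" where
  "is_cycle N \<gamma> \<longleftrightarrow> is_path N \<gamma> \<and> 2 \<le> length \<gamma> \<and> hd \<gamma> = last \<gamma>"

definition excursion :: "('r, 'v::finite) network \<Rightarrow> 'v \<Rightarrow> 'v \<Rightarrow> 'v list \<Rightarrow> bool" where
  "excursion N s t \<gamma> \<longleftrightarrow> is_path N \<gamma> \<and> 2 \<le> length \<gamma> \<and> hd \<gamma> = s \<and> last \<gamma> = t \<and>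
     s \<notin> set (butlast (tl \<gamma>))"

definition simple :: "'v list \<Rightarrow> bool" where
  "simple \<gamma> \<longleftrightarrow> (if hd \<gamma> = last \<gamma> then distinct (tl \<gamma>) else distinct \<gamma>)"

text \<open>\<open>\<lfloor>log\<^sub>b k\<^bsub>\<sigma>\<rightarrow>\<sigma>'\<^esub>\<rfloor>\<close> is constant for large \<open>b\<close> (see \<open>eventually_edge_scale\<close> below);
  the scale is this constant.\<close>

definition edge_scale :: "('r, 'v::finite) network \<Rightarrow> 'v \<Rightarrow> 'v \<Rightarrow> int" where
  "edge_scale N \<sigma> \<sigma>' = (THE n. \<forall>\<^sub>F b in at_top. \<lfloor>log b (trans_rate N b \<sigma> \<sigma>')\<rfloor> = n)"

definition vertex_scale :: "('r, 'v::finite) network \<Rightarrow> 'v \<Rightarrow> int" where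
  "vertex_scale N \<sigma> = Max (edge_scale N \<sigma> ` {\<sigma>'. edge N \<sigma> \<sigma>'})"

definition dominant :: "('r, 'v::finite) network \<Rightarrow> 'v list \<Rightarrow> bool" where
  "dominant N \<gamma> \<longleftrightarrow>
     (\<forall>i<length \<gamma> - 1. edge_scale N (\<gamma> ! i) (\<gamma> ! Suc i) = vertex_scale N (\<gamma> ! i))"

definition depth :: "('r, 'v::finite) network \<Rightarrow> 'v list \<Rightarrow> int" where
  "depth N \<gamma> =
     (\<Sum>i<length \<gamma> - 1. vertex_scale N (\<gamma> ! i) - edge_scale N (\<gamma> ! i) (\<gamma> ! Suc i))"

definition dominant_hypothesis :: "('r, 'v::finite) network \<Rightarrow> 'v \<Rightarrow> bool" where
  "dominant_hypothesis N s \<longleftrightarrow>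
     (\<exists>\<gamma>. is_cycle N \<gamma> \<and> dominant N \<gamma> \<and> s \<in> set \<gamma>) \<and>
     (\<forall>\<gamma>. is_cycle N \<gamma> \<and> dominant N \<gamma> \<longrightarrow> s \<in> set \<gamma>)"

text \<open>Meant for \<open>s \<noteq> t\<close>.\<close>

definition leading :: "('r, 'v::finite) network \<Rightarrow> 'v \<Rightarrow> 'v \<Rightarrow> 'v list \<Rightarrow> bool" where
  "leading N s t \<gamma> \<longleftrightarrow> excursion N s t \<gamma> \<and>
     (\<forall>\<delta>. is_path N \<delta> \<and> hd \<delta> = s \<and> last \<delta> = t \<longrightarrow> depth N \<gamma> \<le> depth N \<delta>)"

definition edge_weight :: "('r, 'v::finite) network \<Rightarrow> real \<Rightarrow> real \<Rightarrow> 'v \<Rightarrow> 'v \<Rightarrow> real" where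
  "edge_weight N b \<alpha> \<sigma> \<sigma>' = trans_rate N b \<sigma> \<sigma>' / (diag_rate N b \<sigma> + \<alpha>)"

definition weight :: "('r, 'v::finite) network \<Rightarrow> real \<Rightarrow> real \<Rightarrow> 'v list \<Rightarrow> real" where
  "weight N b \<alpha> \<gamma> = (\<Prod>i<length \<gamma> - 1. edge_weight N b \<alpha> (\<gamma> ! i) (\<gamma> ! Suc i))"

text \<open>The weight \<open>w\<tilde>(0)\<close>: transition probabilities of the embedded Markov chain.\<close>

definition markov_weight :: "('r, 'v::finite) network \<Rightarrow> real \<Rightarrow> 'v list \<Rightarrow> real" where
  "markov_weight N b \<gamma> =
     (\<Prod>i<length \<gamma> - 1. trans_rate N b (\<gamma> ! i) (\<gamma> ! Suc i) / out_rate N b (\<gamma> ! i))"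

text \<open>Sums over excursions have nonnegative terms.  If every dominant cycle passes through \<open>s\<close>, those
  used here converge for large \<open>b\<close>, which is all that the asymptotic relations see; where such a
  sum diverges, \<open>infsum\<close> is 0 by convention.\<close>

definition excursion_sum :: "('r, 'v::finite) network \<Rightarrow> real \<Rightarrow> real \<Rightarrow> 'v \<Rightarrow> 'v \<Rightarrow> real" where
  "excursion_sum N b \<alpha> s t = (\<Sum>\<^sub>\<infinity>\<gamma>\<in>{\<gamma>. excursion N s t \<gamma>}. weight N b \<alpha> \<gamma>)"

text \<open>\<open>path_growth N b \<gamma>\<close> is \<open>\<epsilon>\<^sub>\<gamma>\<close>.\<close>

definition path_growth :: "('r, 'v::finite) network \<Rightarrow> real \<Rightarrow> 'v list \<Rightarrow> real" where
  "path_growth N b \<gamma> = (\<Prod>i<length \<gamma> - 1. 1 + rel_growth N b (\<gamma> ! i)) - 1"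

text \<open>The lower end \<open>None\<close> stands for \<open>-\<infinity>\<close>.\<close>

definition scale_window :: "('r, 'v::finite) network \<Rightarrow> int option \<Rightarrow> int \<Rightarrow> bool" where
  "scale_window N lo hi \<longleftrightarrow> hi \<in> range (vertex_scale N) \<and>
     (case lo of
        None \<Rightarrow> (\<forall>m\<in>range (vertex_scale N). hi \<le> m)
      | Some n \<Rightarrow> n \<in> range (vertex_scale N) \<and> n < hi \<and>
          \<not> (\<exists>m\<in>range (vertex_scale N). n < m \<and> m < hi))"

definition high_excursions :: "('r, 'v::finite) network \<Rightarrow> 'v \<Rightarrow> int \<Rightarrow> 'v list set" where
  "high_excursions N s hi = {\<gamma>. excursion N s s \<gamma> \<and> (\<forall>\<sigma>\<in>set \<gamma>. hi \<le> vertex_scale N \<sigma>)}"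

definition low_excursions :: "('r, 'v::finite) network \<Rightarrow> 'v \<Rightarrow> int \<Rightarrow> 'v list set" where
  "low_excursions N s hi = {\<gamma>. excursion N s s \<gamma>} - high_excursions N s hi"

definition delta_c_high :: "('r, 'v::finite) network \<Rightarrow> 'v \<Rightarrow> int \<Rightarrow> real \<Rightarrow> real" where
  "delta_c_high N s hi b =
     - 1 + (\<Sum>\<^sub>\<infinity>\<gamma>\<in>high_excursions N s hi. (1 + path_growth N b \<gamma>) * markov_weight N b \<gamma>)"

text \<open>The formula for \<open>weight\<close> also makes sense for \<open>\<alpha>\<close> slightly below 0, so the derivative at 0 is the
  two-sided one; it agrees with the derivative from the right.\<close>

definition c'_high :: "('r, 'v::finite) network \<Rightarrow> 'v \<Rightarrow> int \<Rightarrow> real \<Rightarrow> real" where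
  "c'_high N s hi b =
     - deriv (\<lambda>\<alpha>. \<Sum>\<^sub>\<infinity>\<gamma>\<in>high_excursions N s hi. weight N b \<alpha> \<gamma>) 0"

definition alpha_thr :: "('r, 'v::finite) network \<Rightarrow> 'v \<Rightarrow> int \<Rightarrow> real \<Rightarrow> real" where
  "alpha_thr N s hi b = delta_c_high N s hi b / c'_high N s hi b"

definition window_contains :: "int option \<Rightarrow> int \<Rightarrow> (real \<Rightarrow> real) \<Rightarrow> bool" where
  "window_contains lo hi x \<longleftrightarrow> (\<forall>\<^sub>F b in at_top. 0 < x b) \<and>
     (case lo of None \<Rightarrow> True | Some n \<Rightarrow> (\<lambda>b. b powi n) \<prec> x) \<and>
     x \<prec> (\<lambda>b. b powi hi)"

definition S_high :: "('r, 'v::finite) network \<Rightarrow> 'v \<Rightarrow> int \<Rightarrow> real \<Rightarrow> real" where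
  "S_high N s hi b = (\<Sum>\<^sub>\<infinity>\<gamma>\<in>high_excursions N s hi. path_growth N b \<gamma> * markov_weight N b \<gamma>)"

definition S_low :: "('r, 'v::finite) network \<Rightarrow> 'v \<Rightarrow> int \<Rightarrow> real \<Rightarrow> real" where
  "S_low N s hi b = (\<Sum>\<^sub>\<infinity>\<gamma>\<in>low_excursions N s hi. markov_weight N b \<gamma>)"

definition away_from_transition :: "('r, 'v::finite) network \<Rightarrow> 'v \<Rightarrow> int \<Rightarrow> bool" where
  "away_from_transition N s hi \<longleftrightarrow>
     S_low N s hi \<prec> S_high N s hi \<or> (\<forall>\<^sub>F b in at_top. S_low N s hi b = 0) \<or>
     S_high N s hi \<prec> S_low N s hi"

definition lyapunov_eigenvector :: "('r, 'v::finite) network \<Rightarrow> real \<Rightarrow> real ^ 'v \<Rightarrow> bool" where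
  "lyapunov_eigenvector N b v \<longleftrightarrow>
     (\<forall>\<sigma>. 0 < v $ \<sigma>) \<and> generator N b *v v = lyapunov_exponent N b *s v"

definition lyapunov_weight :: "('r, 'v::finite) network \<Rightarrow> real \<Rightarrow> real ^ 'v \<Rightarrow> 'v \<Rightarrow> real" where
  "lyapunov_weight N b v \<sigma> = (\<bar>generator N b $ \<sigma> $ \<sigma>\<bar> + lyapunov_exponent N b) * v $ \<sigma>"

lemma trans_rate_eq:
  assumes "\<sigma> \<noteq> \<sigma>'"
  shows "trans_rate N b \<sigma> \<sigma>' =
    (\<Sum>\<rho> | \<rho> \<in> reactions N \<and> reactant N \<rho> = \<sigma>.
       real (count (products N \<rho>) \<sigma>') * (rate_coeff N \<rho> * b powi rate_expo N \<rho>))"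
  using assms by (auto simp: trans_rate_def generator_def reaction_rate_def intro!: sum.cong)

lemma trans_rate_pos_iff:
  assumes "wf_network N" "\<sigma> \<noteq> \<sigma>'" "1 < b"
  shows "0 < trans_rate N b \<sigma> \<sigma>' \<longleftrightarrow>
    (\<exists>\<rho>\<in>reactions N. reactant N \<rho> = \<sigma> \<and> \<sigma>' \<in># products N \<rho>)"
proof -
  let ?R = "{\<rho>. \<rho> \<in> reactions N \<and> reactant N \<rho> = \<sigma>}"
  let ?g = "\<lambda>\<rho>. real (count (products N \<rho>) \<sigma>') * (rate_coeff N \<rho> * b powi rate_expo N \<rho>)"
  have fin: "finite ?R" using assms(1) by (simp add: wf_network_def)
  have pos: "0 < rate_coeff N \<rho> * b powi rate_expo N \<rho>" if "\<rho> \<in> ?R" for \<rho>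
  proof -
    have "1 \<le> rate_coeff N \<rho>" using that assms(1) by (auto simp: wf_network_def)
    then show ?thesis using assms(3) by simp
  qed
  have nn: "0 \<le> ?g \<rho>" if "\<rho> \<in> ?R" for \<rho>
    using less_imp_le[OF pos[OF that]] by (rule mult_nonneg_nonneg[OF of_nat_0_le_iff])
  have "0 < sum ?g ?R \<longleftrightarrow> (\<exists>\<rho>\<in>?R. ?g \<rho> \<noteq> 0)"
  proof -
    have "sum ?g ?R = 0 \<longleftrightarrow> (\<forall>\<rho>\<in>?R. ?g \<rho> = 0)"
      by (rule sum_nonneg_eq_0_iff[OF fin nn])
    moreover have "0 \<le> sum ?g ?R" by (rule sum_nonneg[OF nn])
    ultimately have "0 < sum ?g ?R \<longleftrightarrow> \<not> (\<forall>\<rho>\<in>?R. ?g \<rho> = 0)" by linarith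
    then show ?thesis by blast
  qed
  also have "\<dots> \<longleftrightarrow> (\<exists>\<rho>\<in>?R. \<sigma>' \<in># products N \<rho>)"
  proof (rule bex_cong[OF refl])
    fix \<rho> assume "\<rho> \<in> ?R"
    then have "rate_coeff N \<rho> * b powi rate_expo N \<rho> \<noteq> 0"
      using pos less_irrefl by metis
    then show "?g \<rho> \<noteq> 0 \<longleftrightarrow> \<sigma>' \<in># products N \<rho>"
      by (simp add: not_in_iff)
  qed
  finally show ?thesis by (auto simp: trans_rate_eq[OF assms(2)])
qed

lemma edge_iff:
  assumes "wf_network N" "1 < b"
  shows "edge N \<sigma> \<sigma>' \<longleftrightarrow> \<sigma> \<noteq> \<sigma>' \<and> 0 < trans_rate N b \<sigma> \<sigma>'"
  using trans_rate_pos_iff[OF assms(1)] assms(2) unfolding edge_def by blast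

lemma eventually_edge_scale:
  assumes wf: "wf_network N" and e: "edge N \<sigma> \<sigma>'"
  shows "\<forall>\<^sub>F b in at_top. \<lfloor>log b (trans_rate N b \<sigma> \<sigma>')\<rfloor> = edge_scale N \<sigma> \<sigma>'"
proof -
  let ?R = "{\<rho>. \<rho> \<in> reactions N \<and> reactant N \<rho> = \<sigma> \<and> \<sigma>' \<in># products N \<rho>}"
  let ?c = "\<lambda>\<rho>. real (count (products N \<rho>) \<sigma>') * rate_coeff N \<rho>"
  have ne: "\<sigma> \<noteq> \<sigma>'" using e by (simp add: edge_def)
  have fin: "finite ?R" "finite {\<rho>. \<rho> \<in> reactions N \<and> reactant N \<rho> = \<sigma>}"
    using wf by (simp_all add: wf_network_def)
  have "0 < trans_rate N 2 \<sigma> \<sigma>'" using e by (simp add: edge_def)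
  then have Rne: "?R \<noteq> {}" using trans_rate_pos_iff[OF wf ne, of 2] by auto
  have k: "trans_rate N b \<sigma> \<sigma>' = (\<Sum>\<rho>\<in>?R. ?c \<rho> * b powi rate_expo N \<rho>)" for b
    unfolding trans_rate_eq[OF ne]
    by (rule sum.mono_neutral_cong_right[OF fin(2)]) (auto simp: not_in_iff)
  have c1: "1 \<le> ?c \<rho>" if "\<rho> \<in> ?R" for \<rho>
  proof -
    have "1 \<le> real (count (products N \<rho>) \<sigma>')" using that by (auto simp: Suc_le_eq)
    moreover have "1 \<le> rate_coeff N \<rho>" using that wf by (auto simp: wf_network_def)
    ultimately show ?thesis
      using mult_mono[of 1 "real (count (products N \<rho>) \<sigma>')" 1 "rate_coeff N \<rho>"] by simp
  qed
  define m where "m = Max (rate_expo N ` ?R)"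
  obtain \<rho>0 where r0: "\<rho>0 \<in> ?R" "rate_expo N \<rho>0 = m"
  proof -
    have "m \<in> rate_expo N ` ?R" unfolding m_def using fin(1) Rne by (intro Max_in) auto
    then show ?thesis using that by blast
  qed
  have le: "rate_expo N \<rho> \<le> m" if "\<rho> \<in> ?R" for \<rho>
    unfolding m_def using fin(1) that by (intro Max_ge) auto
  have ev: "\<forall>\<^sub>F b in at_top. \<lfloor>log b (trans_rate N b \<sigma> \<sigma>')\<rfloor> = m"
    using eventually_gt_at_top[of "1 + sum ?c ?R"]
  proof eventually_elim
    case (elim b)
    have "0 \<le> sum ?c ?R" using c1 by (intro sum_nonneg) (rule order_trans[OF zero_le_one])
    with elim have b: "1 < b" "sum ?c ?R < b" by auto
    have "b powi m \<le> ?c \<rho>0 * b powi m"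
      using mult_right_mono[OF c1[OF r0(1)], of "b powi m"] b by auto
    also have "\<dots> \<le> trans_rate N b \<sigma> \<sigma>'"
    proof -
      have "0 \<le> ?c \<rho> * b powi rate_expo N \<rho>" if "\<rho> \<in> ?R" for \<rho>
        using c1[OF that] b by (intro mult_nonneg_nonneg[OF order_trans[OF zero_le_one]]) auto
      then show ?thesis
        unfolding k r0(2)[symmetric] using fin(1) r0(1)
        by (intro member_le_sum[where f = "\<lambda>\<rho>. ?c \<rho> * b powi rate_expo N \<rho>"]) auto
    qed
    finally have lo: "b powi m \<le> trans_rate N b \<sigma> \<sigma>'" .
    have "trans_rate N b \<sigma> \<sigma>' \<le> (\<Sum>\<rho>\<in>?R. ?c \<rho> * b powi m)"
      unfolding k
    proof (rule sum_mono)
      fix \<rho> assume rho: "\<rho> \<in> ?R"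
      show "?c \<rho> * b powi rate_expo N \<rho> \<le> ?c \<rho> * b powi m"
        using le[OF rho] c1[OF rho] b
        by (intro mult_left_mono power_int_increasing) linarith+
    qed
    also have "\<dots> = sum ?c ?R * b powi m" by (simp add: sum_distrib_right)
    also have "\<dots> < b * b powi m" using b by (intro mult_strict_right_mono) auto
    also have "\<dots> = b powi (m + 1)" using b by (simp add: power_int_add)
    finally have hi: "trans_rate N b \<sigma> \<sigma>' < b powi (m + 1)" .
    have "0 < b powi m" using b by simp
    with lo have p: "0 < trans_rate N b \<sigma> \<sigma>'" by linarith
    have "real_of_int m \<le> log b (trans_rate N b \<sigma> \<sigma>')"
      using lo b p by (simp add: le_log_iff powr_real_of_int')
    moreover have "log b (trans_rate N b \<sigma> \<sigma>') < real_of_int (m + 1)"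
      using hi b p by (simp add: log_less_iff powr_real_of_int' del: of_int_add)
    ultimately show ?case by (simp add: floor_eq_iff)
  qed
  have "edge_scale N \<sigma> \<sigma>' = m"
    unfolding edge_scale_def
  proof (rule the_equality)
    show "\<forall>\<^sub>F b in at_top. \<lfloor>log b (trans_rate N b \<sigma> \<sigma>')\<rfloor> = m" by (rule ev)
  next
    fix n assume "\<forall>\<^sub>F b in at_top. \<lfloor>log b (trans_rate N b \<sigma> \<sigma>')\<rfloor> = n"
    with ev have "\<forall>\<^sub>F b::real in at_top. n = m" by eventually_elim simp
    then show "n = m" by simp
  qed
  with ev show ?thesis by simp
qed

end

theory Submission
  imports Defs
begin

text \<open>The vector \<open>\<pi>\<^sup>*\<close> is invariant under the weights \<open>w(\<lambda>\<^sup>*)\<close>, so decomposing walks at their last visit to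
  \<open>s\<close> gives \<open>\<pi>\<^sup>*\<^sub>\<sigma> = \<pi>\<^sup>*\<^sub>s f(\<lambda>\<^sup>*)\<close>, the sum running over excursions from \<open>s\<close> to \<open>\<sigma>\<close>; for \<open>\<sigma> = s\<close> this says
  \<open>f(\<lambda>\<^sup>*) = 1\<close>. Since these sums are bounded, \<open>\<pi>\<^sup>*\<^sub>s \<simeq> 1\<close>, and it remains to see \<open>\<alpha>\<^sub>t\<^sub>h\<^sub>r \<simeq> \<lambda>\<^sup>*\<close>.

  Let \<open>h\<close> and \<open>l\<close> be the parts of the return sum carried by high and by low excursions. As \<open>h\<close> is
  convex, \<open>h(\<alpha>\<^sub>t\<^sub>h\<^sub>r) \<ge> h(0) + h'(0) \<alpha>\<^sub>t\<^sub>h\<^sub>r = 1 \<ge> h(\<lambda>\<^sup>*)\<close>, whence \<open>\<alpha>\<^sub>t\<^sub>h\<^sub>r \<le> \<lambda>\<^sup>*\<close>. Conversely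
  \<open>h(0) - h(\<alpha>) \<ge> c \<alpha> \<bar>h'(0)\<bar>\<close> for \<open>\<alpha>\<close> below the high scales, and \<open>l \<le> C S\<^sub>l\<^sub>o\<^sub>w\<close> is negligible against
  \<open>h(0) - 1 = S\<^sub>h\<^sub>i\<^sub>g\<^sub>h - S\<^sub>l\<^sub>o\<^sub>w\<close>, so \<open>h + l < 1\<close> at a fixed multiple of \<open>\<alpha>\<^sub>t\<^sub>h\<^sub>r\<close>.

  Both estimates reduce to walks of bounded length: a long walk contains a loop avoiding \<open>s\<close>, whose
  weight tends to 0 because it is not dominant, and erasing that loop is injective once its position and
  the loop itself are recorded.\<close>

section \<open>Walks and loop erasure\<close>

fun walk_weight :: "('v \<Rightarrow> 'v \<Rightarrow> real) \<Rightarrow> 'v list \<Rightarrow> real" where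
  "walk_weight W (x # y # ys) = W x y * walk_weight W (y # ys)"
| "walk_weight W _ = 1"

lemma walk_weight_conv_prod:
  "walk_weight W \<gamma> = (\<Prod>i<length \<gamma> - 1. W (\<gamma> ! i) (\<gamma> ! Suc i))"
  by (induction W \<gamma> rule: walk_weight.induct) (simp_all add: prod.lessThan_Suc_shift del: prod.lessThan_Suc)

lemma walk_weight_append:
  "walk_weight W (xs @ x # ys) = walk_weight W (xs @ [x]) * walk_weight W (x # ys)"
  by (induction xs rule: induct_list012) (cases ys, simp_all)

lemma walk_weight_rev: "walk_weight (\<lambda>x y. W y x) (rev \<gamma>) = walk_weight W \<gamma>"
proof (induction W \<gamma> rule: walk_weight.induct)
  case (1 W x y ys)
  then show ?case
    using walk_weight_append[of "\<lambda>x y. W y x" "rev ys" y "[x]"] by (simp add: mult.commute)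
qed auto

lemma walk_weight_mono:
  assumes "successively E \<gamma>" "\<And>x y. E x y \<Longrightarrow> 0 \<le> W x y" "\<And>x y. E x y \<Longrightarrow> W x y \<le> W' x y"
  shows "0 \<le> walk_weight W \<gamma>" "walk_weight W \<gamma> \<le> walk_weight W' \<gamma>"
proof -
  have "0 \<le> walk_weight W \<gamma> \<and> walk_weight W \<gamma> \<le> walk_weight W' \<gamma>" using assms(1)
    by (induction \<gamma> rule: induct_list012) (auto intro!: mult_mono simp: assms(2,3) order_trans[OF assms(2,3)])
  then show "0 \<le> walk_weight W \<gamma>" "walk_weight W \<gamma> \<le> walk_weight W' \<gamma>" by auto
qed

text \<open>A factor belonging to the source of each edge is collected once for every vertex but the
  last, hence \<open>butlast\<close>. This separates the dependence on the shift of the rates from a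
  weight.\<close>

lemma walk_weight_scale:
  "walk_weight (\<lambda>x y. W x y * c x) \<gamma> = walk_weight W \<gamma> * prod_list (map c (butlast \<gamma>))"
  by (induction W \<gamma> rule: walk_weight.induct) (auto simp: algebra_simps)

section \<open>Sums over walks as limits of truncations by length\<close>

lemma finite_lists_length_le_UNIV [simp]: "finite {\<gamma>::'v::finite list. P \<gamma> \<and> length \<gamma> \<le> m}"
  by (rule finite_subset[OF _ finite_lists_length_le[of UNIV m]]) auto

text \<open>Over a finite vertex type the truncations by length are finite sets that absorb every
  finite subset of \<open>A\<close>. For nonnegative terms their limit therefore bounds all finite
  partial sums, which gives summability, and it agrees with the unordered sum.\<close>

lemma has_sum_by_length:
  fixes f :: "'v::finite list \<Rightarrow> real"
  assumes "\<And>\<gamma>. \<gamma> \<in> A \<Longrightarrow> 0 \<le> f \<gamma>"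
    and lim: "(\<lambda>m. \<Sum>\<gamma> | \<gamma> \<in> A \<and> length \<gamma> \<le> m. f \<gamma>) \<longlonglongrightarrow> l"
  shows "(f has_sum l) A"
proof -
  let ?A = "\<lambda>m. {\<gamma>. \<gamma> \<in> A \<and> length \<gamma> \<le> m}"
  have inc: "incseq (\<lambda>m. sum f (?A m))"
    by (intro incseq_SucI sum_mono2) (use assms(1) in auto)
  have sub: "\<exists>m. F \<subseteq> ?A m" if "finite F" "F \<subseteq> A" for F
    using that by (intro exI[of _ "Max (length ` F)"]) auto
  have "f summable_on A"
  proof (rule nonneg_bdd_above_summable_on[OF assms(1)])
    show "bdd_above (sum f ` {F. F \<subseteq> A \<and> finite F})"
    proof (intro bdd_aboveI[of _ l], safe)
      fix F assume F: "F \<subseteq> A" "finite F"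
      with sub obtain m where "F \<subseteq> ?A m" by blast
      then have "sum f F \<le> sum f (?A m)" by (intro sum_mono2) (use assms(1) in auto)
      also have "\<dots> \<le> l" using incseq_le[OF inc lim] .
      finally show "sum f F \<le> l" .
    qed
  qed
  then have "(f has_sum infsum f A) A" by simp
  moreover have "filterlim ?A (finite_subsets_at_top A) sequentially"
    unfolding filterlim_finite_subsets_at_top
  proof safe
    fix F assume F: "finite F" "F \<subseteq> A"
    with sub obtain m where m: "F \<subseteq> ?A m" by blast
    show "\<forall>\<^sub>F n in sequentially. finite (?A n) \<and> F \<subseteq> ?A n \<and> ?A n \<subseteq> A"
      using eventually_ge_at_top[of m] by eventually_elim (use m in auto)
  qed
  ultimately have "(\<lambda>m. sum f (?A m)) \<longlonglongrightarrow> infsum f A"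
    unfolding has_sum_def by (rule filterlim_compose)
  with lim have "l = infsum f A" by (rule LIMSEQ_unique)
  with \<open>f summable_on A\<close> show ?thesis by simp
qed

lemma summable_on_by_length:
  fixes f :: "'v::finite list \<Rightarrow> real"
  assumes "\<And>\<gamma>. \<gamma> \<in> A \<Longrightarrow> 0 \<le> f \<gamma>"
    and bound: "\<And>m. (\<Sum>\<gamma> | \<gamma> \<in> A \<and> length \<gamma> \<le> m. f \<gamma>) \<le> B"
  shows "f summable_on A" "infsum f A \<le> B"
proof -
  have inc: "incseq (\<lambda>m. \<Sum>\<gamma> | \<gamma> \<in> A \<and> length \<gamma> \<le> m. f \<gamma>)"
    by (intro incseq_SucI sum_mono2) (use assms(1) in auto)
  obtain l where l: "(\<lambda>m. \<Sum>\<gamma> | \<gamma> \<in> A \<and> length \<gamma> \<le> m. f \<gamma>) \<longlonglongrightarrow> l"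
    using incseq_convergent[OF inc] bound by blast
  then have "(f has_sum l) A" by (intro has_sum_by_length assms(1))
  moreover have "l \<le> B" by (rule LIMSEQ_le_const2[OF l]) (use bound in auto)
  ultimately show "f summable_on A" "infsum f A \<le> B"
    by (auto simp: infsumI summable_on_def)
qed

section \<open>Short loops away from a base vertex and their erasure\<close>

definition short :: "'v::finite itself \<Rightarrow> nat" where
  "short _ = CARD('v) + 2"

text \<open>The denominator counts the ways to insert a short loop near the start of a walk, so that all
  insertions together contribute at most half of the total weight.\<close>

definition loop_bound :: "'v::finite itself \<Rightarrow> real" where
  "loop_bound _ = inverse (2 * real (card ({..short TYPE('v)} \<times> {c::'v list. length c \<le> short TYPE('v)})))"

text \<open>Only short loops that avoid \<open>s\<close> are constrained; longer walks are handled
  by erasing such loops. The weights leaving a vertex may sum to more than 1, as they can when a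
  reaction has two products. The length bound counts the closing vertex once.\<close>

locale small_loops =
  fixes E :: "'v::finite \<Rightarrow> 'v \<Rightarrow> bool" and W :: "'v \<Rightarrow> 'v \<Rightarrow> real" and s :: 'v
  assumes nonneg: "E x y \<Longrightarrow> 0 \<le> W x y"
    and small: "\<lbrakk>s \<notin> set (x # xs); successively E (x # xs @ [x]); length (x # xs) \<le> short TYPE('v)\<rbrakk>
      \<Longrightarrow> walk_weight W (x # xs @ [x]) \<le> loop_bound TYPE('v)"
begin

lemma walk_nonneg: "successively E \<gamma> \<Longrightarrow> 0 \<le> walk_weight W \<gamma>"
  by (rule walk_weight_mono(1)[where E = E and W' = W]) (auto intro: nonneg)

text \<open>The leading \<open>u\<close> and the condition \<open>cs \<noteq> []\<close> protect the
  two ends of the walk. Families described by their end points are thereby covered, and the erased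
  loop lies in the range where \<open>s\<close> is excluded.\<close>

definition loop_erasable :: "'v list set \<Rightarrow> bool" where
  "loop_erasable P \<longleftrightarrow>
     (\<forall>\<gamma>\<in>P. successively E \<gamma> \<and> s \<notin> set (butlast (tl \<gamma>))) \<and>
     (\<forall>u as x bs cs. u # as @ x # bs @ x # cs \<in> P \<longrightarrow> cs \<noteq> [] \<longrightarrow> u # as @ x # cs \<in> P)"

text \<open>Pigeonhole near the start of the walk. Not only the loop but also its position has to be
  bounded, because both are recorded in order to undo the erasure.\<close>

lemma long_has_loop:
  assumes P: "loop_erasable P" and \<gamma>: "\<gamma> \<in> P" "short TYPE('v) < length \<gamma>"
  obtains as x bs cs where "\<gamma> = as @ x # bs @ x # cs" "as @ x # cs \<in> P"
    "length as \<le> short TYPE('v)" "length (x # bs) \<le> short TYPE('v)" "s \<notin> set (x # bs)"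
    "successively E (x # bs @ [x])"
proof -
  obtain u \<delta> where u: "\<gamma> = u # \<delta>" "CARD('v) + 1 < length \<delta>"
    using \<gamma>(2) by (cases \<gamma>) (auto simp: short_def)
  \<comment> \<open>\<open>short\<close> is two more than the number of vertices: one vertex in
    front of this window is skipped, the \<open>CARD('v) + 1\<close> vertices of the window repeat
    one, and at least one vertex remains behind it. So the loop stays away from both ends.\<close>
  let ?t = "take (CARD('v) + 1) \<delta>"
  have "\<not> distinct ?t"
  proof
    assume "distinct ?t"
    then have "length ?t = card (set ?t)" by (simp add: distinct_card)
    also have "\<dots> \<le> CARD('v)" by (intro card_mono) auto
    finally show False using u(2) by simp
  qed
  then obtain as x bs cs where t: "?t = as @ [x] @ bs @ [x] @ cs"
    using not_distinct_decomp by blast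
  have len: "length as + length bs + length cs + 2 \<le> CARD('v) + 1"
    using arg_cong[OF t, of length] by simp
  define ds where "ds = drop (CARD('v) + 1) \<delta>"
  have d: "\<delta> = as @ x # bs @ x # cs @ ds" "ds \<noteq> []"
    using append_take_drop_id[of "CARD('v) + 1" \<delta>, unfolded t] u(2) by (auto simp: ds_def)
  have \<gamma>E: "successively E \<gamma>" "s \<notin> set (butlast (tl \<gamma>))"
    using P \<gamma>(1) by (auto simp: loop_erasable_def)
  have "u # as @ x # bs @ x # cs @ ds \<in> P" using \<gamma>(1) u(1) d(1) by simp
  then have "u # as @ x # cs @ ds \<in> P"
    using P d(2) unfolding loop_erasable_def by blast
  moreover have "s \<notin> set (x # bs)"
    using \<gamma>E(2) d(2) by (auto simp: u(1) d(1) butlast_append)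
  moreover have "successively E (x # bs @ [x])"
    using \<gamma>E(1) by (simp add: u(1) d(1) successively_append_iff successively_Cons split: if_splits)
       (auto simp: successively_append_iff successively_Cons hd_append)
  ultimately show thesis
    using len by (intro that[of "u # as" x bs "cs @ ds"]) (auto simp: u d short_def)
qed

text \<open>A long walk arises from a walk in \<open>P\<close> by inserting a short loop at an early
  position. Each insertion costs a factor \<open>loop_bound\<close>, so that the long walks carry at
  most half of the sum up to length \<open>m\<close>; absorbing this half leaves a bound uniform in
  \<open>m\<close>.\<close>

lemma short_walks_dominate:
  assumes P: "loop_erasable P"
  shows "(\<Sum>\<gamma> | \<gamma> \<in> P \<and> length \<gamma> \<le> m. walk_weight W \<gamma>) \<le>
    2 * (\<Sum>\<gamma> | \<gamma> \<in> P \<and> length \<gamma> \<le> short TYPE('v). walk_weight W \<gamma>)"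
proof -
  let ?L = "short TYPE('v)"
  let ?P = "\<lambda>m. {\<gamma>. \<gamma> \<in> P \<and> length \<gamma> \<le> m}"
  let ?I = "{..?L} \<times> {c::'v list. length c \<le> ?L}"
  let ?d = "loop_bound TYPE('v)"
  have finI: "finite ?I" using finite_lists_length_le[of "UNIV :: 'v set" ?L] by simp
  have nn: "0 \<le> walk_weight W \<gamma>" if "\<gamma> \<in> P" for \<gamma>
    using P that by (auto simp: loop_erasable_def intro: walk_nonneg)
  have d0: "0 \<le> ?d" by (simp add: loop_bound_def)
  have "(0, []) \<in> ?I" by simp
  then have "card ?I > 0" using finI by (metis card_gt_0_iff empty_iff)
  then have cd: "real (card ?I) * ?d = 1 / 2" unfolding loop_bound_def by (simp add: field_simps)
  have "sum (walk_weight W) (?P m - ?P ?L) \<le> (\<Sum>(q, \<delta>)\<in>?I \<times> ?P m. ?d * walk_weight W \<delta>)"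
  \<comment> \<open>The map decodes a position, a loop and a shorter walk into a walk, so different
    walks cannot share a code.\<close>
  proof (rule sum_le_included[where i = "\<lambda>((i, c), \<delta>). take i \<delta> @ c @ drop i \<delta>"])
    show "\<forall>y\<in>?I \<times> ?P m. 0 \<le> (case y of (q, \<delta>) \<Rightarrow> ?d * walk_weight W \<delta>)"
      using nn d0 by auto
    show "\<forall>\<gamma>\<in>?P m - ?P ?L. \<exists>y\<in>?I \<times> ?P m.
        (case y of (q, \<delta>) \<Rightarrow> (case q of (i, c) \<Rightarrow> \<lambda>\<delta>. take i \<delta> @ c @ drop i \<delta>) \<delta>) = \<gamma> \<and>
        walk_weight W \<gamma> \<le> (case y of (q, \<delta>) \<Rightarrow> ?d * walk_weight W \<delta>)"
    proof
      fix \<gamma> assume g: "\<gamma> \<in> ?P m - ?P ?L"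
      then have "\<gamma> \<in> P" "?L < length \<gamma>" by auto
      from long_has_loop[OF P this] obtain as x bs cs where l: "\<gamma> = as @ x # bs @ x # cs"
        "as @ x # cs \<in> P" "length as \<le> ?L" "length (x # bs) \<le> ?L" "s \<notin> set (x # bs)"
        "successively E (x # bs @ [x])" .
      have "walk_weight W \<gamma> = walk_weight W (as @ [x]) * (walk_weight W (x # bs @ [x]) * walk_weight W (x # cs))"
        using walk_weight_append[of W as x "bs @ x # cs"] walk_weight_append[of W "x # bs" x cs] l(1) by simp
      also have "\<dots> = walk_weight W (x # bs @ [x]) * walk_weight W (as @ x # cs)"
        using walk_weight_append[of W as x cs] by simp
      also have "\<dots> \<le> ?d * walk_weight W (as @ x # cs)"
        using small[OF l(5,6,4)] nn[OF l(2)] by (rule mult_right_mono)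
      finally show "\<exists>y\<in>?I \<times> ?P m.
        (case y of (q, \<delta>) \<Rightarrow> (case q of (i, c) \<Rightarrow> \<lambda>\<delta>. take i \<delta> @ c @ drop i \<delta>) \<delta>) = \<gamma> \<and>
        walk_weight W \<gamma> \<le> (case y of (q, \<delta>) \<Rightarrow> ?d * walk_weight W \<delta>)"
        using l g by (intro bexI[of _ "((length as, x # bs), as @ x # cs)"]) auto
    qed
  qed (use finI in \<open>auto intro: finite_SigmaI\<close>)
  also have "\<dots> = real (card ?I) * ?d * sum (walk_weight W) (?P m)"
    by (subst sum.cartesian_product[symmetric]) (simp add: sum_distrib_left mult.assoc del: card_cartesian_product)
  finally have "sum (walk_weight W) (?P m - ?P ?L) \<le> sum (walk_weight W) (?P m) / 2"
    unfolding cd by simp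
  moreover have "sum (walk_weight W) (?P m) \<le> sum (walk_weight W) (?P m - ?P ?L) + sum (walk_weight W) (?P ?L)"
  proof -
    have "sum (walk_weight W) (?P m) \<le> sum (walk_weight W) ((?P m - ?P ?L) \<union> ?P ?L)"
      by (rule sum_mono2) (use nn in auto)
    also have "\<dots> = sum (walk_weight W) (?P m - ?P ?L) + sum (walk_weight W) (?P ?L)"
      by (rule sum.union_disjoint) auto
    finally show ?thesis .
  qed
  ultimately show ?thesis by linarith
qed

end

section \<open>Excursions, additive costs along them and the invariance equation\<close>

definition excursions :: "('v \<Rightarrow> 'v \<Rightarrow> bool) \<Rightarrow> 'v \<Rightarrow> 'v \<Rightarrow> 'v list set" where
  "excursions E s t = {\<gamma>. successively E \<gamma> \<and> 2 \<le> length \<gamma> \<and> hd \<gamma> = s \<and> last \<gamma> = t \<and>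
     s \<notin> set (butlast (tl \<gamma>))}"

text \<open>The last vertex emits no edge and is not charged. With the inverse rates as
  \<open>c\<close> this is minus the logarithmic derivative of the weight of the walk at shift
  0.\<close>

definition walk_cost :: "('v \<Rightarrow> real) \<Rightarrow> 'v list \<Rightarrow> real" where
  "walk_cost c \<gamma> = sum_list (map c (butlast \<gamma>))"

lemma walk_cost_conv_sum: "walk_cost c \<gamma> = (\<Sum>i<length \<gamma> - 1. c (\<gamma> ! i))"
  unfolding walk_cost_def by (simp add: sum_list_sum_nth nth_butlast atLeast0LessThan)

lemma walk_cost_nonneg: "(\<And>x. x \<in> set \<gamma> \<Longrightarrow> 0 \<le> c x) \<Longrightarrow> 0 \<le> walk_cost c \<gamma>"
  unfolding walk_cost_def by (intro sum_list_nonneg) (auto dest: in_set_butlastD)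

lemma successively_erase_loop:
  "successively E (as @ x # bs @ x # cs) \<Longrightarrow> successively E (as @ x # cs)"
  by (cases as rule: rev_cases; cases cs)
     (auto simp: successively_append_iff successively_Cons split: if_splits)

context small_loops
begin

text \<open>Erasing an inner loop removes interior vertices only and creates no new edge, so just
  the additional condition \<open>Q\<close> has to be checked.\<close>

lemma loop_erasable_classI:
  assumes "P = {\<gamma>. successively E \<gamma> \<and> s \<notin> set (butlast (tl \<gamma>)) \<and> Q \<gamma>}"
    and "\<And>u as x bs cs. cs \<noteq> [] \<Longrightarrow> Q (u # as @ x # bs @ x # cs) \<Longrightarrow> Q (u # as @ x # cs)"
  shows "loop_erasable P"
  unfolding loop_erasable_def assms(1)
  using successively_erase_loop[of E "_ # _"] by (auto simp: butlast_append intro: assms(2))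

text \<open>Erasing a loop also erases its cost, so loop erasure cannot be applied to the product
  directly. The cost is expanded into a sum over a marked vertex \<open>y\<close>, the excursion is
  cut there, and both pieces are reduced to short ones separately: each contributes a factor 2, and
  the two lengths add up to at most \<open>2 * short\<close>.\<close>

lemma cost_sum_le_short:
  assumes c: "\<And>x. x \<in> U \<Longrightarrow> 0 \<le> c x"
  defines "X \<equiv> excursions E s s \<inter> lists U"
  shows "(\<Sum>\<gamma> | \<gamma> \<in> X \<and> length \<gamma> \<le> m. walk_weight W \<gamma> * walk_cost c \<gamma>) \<le>
    4 * (\<Sum>\<gamma> | \<gamma> \<in> X \<and> length \<gamma> \<le> 2 * short TYPE('v). walk_weight W \<gamma> * walk_cost c \<gamma>)"
proof -
  let ?w = "walk_weight W" and ?L = "short TYPE('v)"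
  \<comment> \<open>\<open>F y\<close> admits the one-vertex walk, for a mark on the starting
    vertex; \<open>H y\<close> has at least one edge because the final vertex carries no
    cost.\<close>
  define F where "F y = {p. successively E p \<and> s \<notin> set (butlast (tl p)) \<and>
    (p \<noteq> [] \<and> hd p = s \<and> last p = y \<and> s \<notin> set (tl p) \<and> set p \<subseteq> U)}" for y
  define H where "H y = {q. successively E q \<and> s \<notin> set (butlast (tl q)) \<and>
    (2 \<le> length q \<and> hd q = y \<and> last q = s \<and> set q \<subseteq> U)}" for y
  let ?F = "\<lambda>m y. {p. p \<in> F y \<and> length p \<le> m}" and ?H = "\<lambda>m y. {q. q \<in> H y \<and> length q \<le> m}"
  let ?X = "\<lambda>m. {\<gamma>. \<gamma> \<in> X \<and> length \<gamma> \<le> m}"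
  let ?M = "\<lambda>m. SIGMA \<gamma>:?X m. {..<length \<gamma> - 1}"
  let ?T = "\<lambda>m. SIGMA y:U. ?F m y \<times> ?H m y"
  let ?f = "\<lambda>(\<gamma>, i). ?w \<gamma> * c (\<gamma> ! i)"
  let ?g = "\<lambda>(y, p, q). c y * (?w p * ?w q)"
  have eF: "loop_erasable (F y)" for y
    by (rule loop_erasable_classI[OF F_def]) auto
  have eH: "loop_erasable (H y)" for y
    by (rule loop_erasable_classI[OF H_def]) auto
  have nF: "0 \<le> ?w p" if "p \<in> F y" for p y using that by (auto simp: F_def intro: walk_nonneg)
  have nH: "0 \<le> ?w q" if "q \<in> H y" for q y using that by (auto simp: H_def intro: walk_nonneg)
  have nX: "0 \<le> ?w \<gamma>" if "\<gamma> \<in> X" for \<gamma>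
    using that by (auto simp: X_def excursions_def intro: walk_nonneg)
  have finU: "finite U" by simp
  have M: "(\<Sum>\<gamma>\<in>?X m. ?w \<gamma> * walk_cost c \<gamma>) = sum ?f (?M m)" for m
    by (subst sum.Sigma[symmetric]) (auto simp: walk_cost_conv_sum sum_distrib_left)
  have T: "sum ?g (?T m) = (\<Sum>y\<in>U. c y * (sum ?w (?F m y) * sum ?w (?H m y)))" for m
  proof -
    have "(\<Sum>(p, q)\<in>A \<times> B. c y * (?w p * ?w q)) = c y * (sum ?w A * sum ?w B)" for A B y
      by (subst sum.cartesian_product[symmetric]) (simp add: sum_distrib_left[symmetric] sum_distrib_right[symmetric])
    then show ?thesis by (subst sum.Sigma[symmetric]) auto
  qed
  have cut: "take (Suc i) \<gamma> \<in> F (\<gamma> ! i)" "drop i \<gamma> \<in> H (\<gamma> ! i)" "\<gamma> ! i \<in> U"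
      "take (Suc i) \<gamma> @ tl (drop i \<gamma>) = \<gamma>" "?w \<gamma> = ?w (take (Suc i) \<gamma>) * ?w (drop i \<gamma>)"
    if "\<gamma> \<in> X" "i < length \<gamma> - 1" for \<gamma> i
  proof -
    have i: "i < length \<gamma>" using that by simp
    have \<gamma>: "\<gamma> = take i \<gamma> @ \<gamma> ! i # drop (Suc i) \<gamma>" using i by (simp add: id_take_nth_drop)
    define as y bs where d: "as = take i \<gamma>" "y = \<gamma> ! i" "bs = drop (Suc i) \<gamma>"
    have g: "\<gamma> = as @ y # bs" using \<gamma> by (simp add: d)
    have t: "take (Suc i) \<gamma> = as @ [y]" "drop i \<gamma> = y # bs" "bs \<noteq> []"
      using i that by (auto simp: d take_Suc_conv_app_nth Cons_nth_drop_Suc)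
    have gX: "successively E (as @ y # bs)" "hd (as @ y # bs) = s" "last bs = s"
      "s \<notin> set (butlast (tl (as @ y # bs)))" "set (as @ y # bs) \<subseteq> U"
      using that(1) t(3) by (auto simp: X_def excursions_def g)
    show "take (Suc i) \<gamma> \<in> F (\<gamma> ! i)"
      unfolding t(1) d(2)[symmetric] F_def using gX t(3)
      by (cases as) (auto simp: successively_append_iff butlast_append successively_Cons hd_append)
    show "drop i \<gamma> \<in> H (\<gamma> ! i)"
      unfolding t(2) d(2)[symmetric] H_def using gX t(3)
      by (cases as; cases bs) (auto simp: successively_append_iff butlast_append successively_Cons hd_append)
    show "\<gamma> ! i \<in> U" using gX(5) d(2) by simp
    show "take (Suc i) \<gamma> @ tl (drop i \<gamma>) = \<gamma>" unfolding t(1,2) by (simp add: g)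
    show "?w \<gamma> = ?w (take (Suc i) \<gamma>) * ?w (drop i \<gamma>)"
      unfolding t(1,2) using walk_weight_append[of W as y bs] by (simp add: g)
  qed
  \<comment> \<open>The cut vertex occurs in both pieces, so one copy is dropped by
    \<open>tl\<close>. Gluing and cutting are inverse to each other.\<close>
  have glue: "p @ tl q \<in> X" "(p @ tl q) ! (length p - 1) = y" "length p - 1 < length (p @ tl q) - 1"
      "take (Suc (length p - 1)) (p @ tl q) = p" "drop (length p - 1) (p @ tl q) = q"
      "length (p @ tl q) \<le> length p + length q"
    if pq: "p \<in> F y" "q \<in> H y" for p q y
  proof -
    obtain as where p: "p = as @ [y]" using pq(1) by (cases p rule: rev_cases) (auto simp: F_def)
    obtain bs where q: "q = y # bs" "bs \<noteq> []" using pq(2)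
      by (cases q; cases "tl q") (auto simp: H_def)
    show "p @ tl q \<in> X" using pq q(2) unfolding p q(1) X_def F_def H_def excursions_def
      by (cases as; cases bs) (auto simp: successively_append_iff butlast_append successively_Cons hd_append)
    show "(p @ tl q) ! (length p - 1) = y" "length p - 1 < length (p @ tl q) - 1"
      "take (Suc (length p - 1)) (p @ tl q) = p" "drop (length p - 1) (p @ tl q) = q"
      "length (p @ tl q) \<le> length p + length q"
      using q(2) by (auto simp: p q(1))
  qed
  have "sum ?f (?M m) \<le> sum ?g (?T m)"
  proof (rule sum_le_included[where i = "\<lambda>(y, p, q). (p @ tl q, length p - 1)"])
    show "\<forall>x\<in>?M m. \<exists>z\<in>?T m. (\<lambda>(y, p, q). (p @ tl q, length p - 1)) z = x \<and> ?f x \<le> ?g z"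
    proof
      fix x assume "x \<in> ?M m"
      then obtain \<gamma> i where x: "x = (\<gamma>, i)"
        and g: "\<gamma> \<in> X" "length \<gamma> \<le> m" "i < length \<gamma> - 1" by auto
      show "\<exists>z\<in>?T m. (\<lambda>(y, p, q). (p @ tl q, length p - 1)) z = x \<and> ?f x \<le> ?g z"
        unfolding x using cut[OF g(1,3)] g
        by (intro bexI[of _ "(\<gamma> ! i, take (Suc i) \<gamma>, drop i \<gamma>)"]) (auto simp: min_def)
    qed
  qed (use c nF nH finU in \<open>auto intro!: mult_nonneg_nonneg finite_SigmaI\<close>)
  also have "\<dots> \<le> 4 * sum ?g (?T ?L)"
  proof -
    have "c y * (sum ?w (?F m y) * sum ?w (?H m y)) \<le>
        4 * (c y * (sum ?w (?F ?L y) * sum ?w (?H ?L y)))" if "y \<in> U" for y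
    proof -
      have "sum ?w (?F m y) * sum ?w (?H m y) \<le> (2 * sum ?w (?F ?L y)) * (2 * sum ?w (?H ?L y))"
        using nF nH by (intro mult_mono short_walks_dominate[OF eF] short_walks_dominate[OF eH])
          (auto intro!: sum_nonneg)
      from mult_left_mono[OF this c[OF that]] show ?thesis by (simp add: mult_ac)
    qed
    then show ?thesis unfolding T sum_distrib_left by (rule sum_mono)
  qed
  \<comment> \<open>Back from pairs of short pieces to marked excursions; the cut recovers the pair,
    so nothing is counted twice.\<close>
  also have "sum ?g (?T ?L) \<le> sum ?f (?M (2 * ?L))"
  proof (rule sum_le_included[where i = "\<lambda>(\<gamma>, i). (\<gamma> ! i, take (Suc i) \<gamma>, drop i \<gamma>)"])
    show "\<forall>z\<in>?T ?L. \<exists>x\<in>?M (2 * ?L). (\<lambda>(\<gamma>, i). (\<gamma> ! i, take (Suc i) \<gamma>, drop i \<gamma>)) x = z \<and> ?g z \<le> ?f x"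
    proof
      fix z assume "z \<in> ?T ?L"
      then obtain y p q where zz: "z = (y, p, q)"
        and z: "y \<in> U" "p \<in> F y" "length p \<le> ?L" "q \<in> H y" "length q \<le> ?L" by auto
      note G = glue[OF z(2,4)]
      show "\<exists>x\<in>?M (2 * ?L). (\<lambda>(\<gamma>, i). (\<gamma> ! i, take (Suc i) \<gamma>, drop i \<gamma>)) x = z \<and> ?g z \<le> ?f x"
        unfolding zz using G z cut(5)[OF G(1,3)]
        by (intro bexI[of _ "(p @ tl q, length p - 1)"]) (auto simp: mult_ac)
    qed
    show "\<forall>y\<in>?M (2 * ?L). 0 \<le> ?f y"
      using nX c cut(3) by (auto intro!: mult_nonneg_nonneg)
  qed (use finU in \<open>auto intro: finite_SigmaI\<close>)
  finally show ?thesis unfolding M by simp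
qed

lemma cost_summable:
  assumes c: "\<And>x. x \<in> U \<Longrightarrow> 0 \<le> c x"
  defines "X \<equiv> excursions E s s \<inter> lists U"
  shows "(\<lambda>\<gamma>. walk_weight W \<gamma> * walk_cost c \<gamma>) summable_on X"
    and "(\<Sum>\<^sub>\<infinity>\<gamma>\<in>X. walk_weight W \<gamma> * walk_cost c \<gamma>) \<le>
      4 * (\<Sum>\<gamma> | \<gamma> \<in> X \<and> length \<gamma> \<le> 2 * short TYPE('v). walk_weight W \<gamma> * walk_cost c \<gamma>)"
proof -
  let ?B = "4 * (\<Sum>\<gamma> | \<gamma> \<in> X \<and> length \<gamma> \<le> 2 * short TYPE('v). walk_weight W \<gamma> * walk_cost c \<gamma>)"
  have nn: "0 \<le> walk_weight W \<gamma> * walk_cost c \<gamma>" if "\<gamma> \<in> X" for \<gamma>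
    using that c by (intro mult_nonneg_nonneg walk_nonneg walk_cost_nonneg)
      (auto simp: X_def excursions_def)
  have bound: "(\<Sum>\<gamma> | \<gamma> \<in> X \<and> length \<gamma> \<le> m. walk_weight W \<gamma> * walk_cost c \<gamma>) \<le> ?B" for m
    unfolding X_def using c by (rule cost_sum_le_short)
  show "(\<lambda>\<gamma>. walk_weight W \<gamma> * walk_cost c \<gamma>) summable_on X"
    "(\<Sum>\<^sub>\<infinity>\<gamma>\<in>X. walk_weight W \<gamma> * walk_cost c \<gamma>) \<le> ?B"
    using summable_on_by_length[OF nn bound] by blast+
qed

lemma weight_summable: "walk_weight W summable_on (excursions E s t \<inter> lists U)"
proof -
  define P where "P = {\<gamma>. successively E \<gamma> \<and> s \<notin> set (butlast (tl \<gamma>)) \<and>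
    (2 \<le> length \<gamma> \<and> hd \<gamma> = s \<and> last \<gamma> = t \<and> set \<gamma> \<subseteq> U)}"
  have e: "loop_erasable P" by (rule loop_erasable_classI[OF P_def]) auto
  have "excursions E s t \<inter> lists U = P" by (auto simp: excursions_def P_def)
  moreover have "walk_weight W summable_on P"
    by (rule summable_on_by_length(1)[OF _ short_walks_dominate[OF e]])
       (auto simp: P_def intro: walk_nonneg)
  ultimately show ?thesis by simp
qed

text \<open>Iterating the invariance equation backwards from \<open>t\<close> stops each walk at its last visit
  to \<open>s\<close>; what has not been stopped yet is the tail of a convergent series.\<close>

lemma invariant_has_sum:
  assumes inv: "\<And>y. p y = (\<Sum>x | E x y. p x * W x y)" and ps: "0 \<le> p s"
  shows "((\<lambda>\<gamma>. p s * walk_weight W \<gamma>) has_sum p t) (excursions E s t)"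
proof -
  let ?w = "walk_weight W"
  \<comment> \<open>\<open>B m\<close> holds the walks with \<open>m\<close> edges into
    \<open>t\<close> that have not met \<open>s\<close>, except possibly at \<open>t\<close> itself.
    \<open>R m\<close> is what remains unresolved after \<open>m\<close> uses of the invariance
    equation.\<close>
  define B where "B m = {\<gamma>. successively E \<gamma> \<and> s \<notin> set (butlast \<gamma>) \<and> last \<gamma> = t \<and> length \<gamma> = Suc m}" for m
  define R where "R m = (\<Sum>\<gamma>\<in>B m. p (hd \<gamma>) * ?w \<gamma>)" for m
  let ?X = "\<lambda>m. {\<gamma>. \<gamma> \<in> excursions E s t \<and> length \<gamma> \<le> m}"
  have finB: "finite (B m)" for m
    by (rule finite_subset[OF _ finite_lists_length_le[of UNIV "Suc m"]]) (auto simp: B_def)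
  \<comment> \<open>One backward step prepends a predecessor: if it is \<open>s\<close>, the walk is
    a completed excursion, otherwise it stays in the unresolved part.\<close>
  have step: "R m = p s * sum ?w {\<gamma>\<in>excursions E s t. length \<gamma> = Suc (Suc m)} + R (Suc m)" for m
  proof -
    let ?Z = "SIGMA \<gamma>:B m. {x. E x (hd \<gamma>)}"
    let ?h = "\<lambda>(\<gamma>, x). p x * ?w (x # \<gamma>)"
    let ?c = "\<lambda>(\<gamma>, x). x # \<gamma>"
    have "R m = (\<Sum>\<gamma>\<in>B m. \<Sum>x | E x (hd \<gamma>). p x * ?w (x # \<gamma>))"
      unfolding R_def
    proof (rule sum.cong[OF refl])
      fix \<gamma> assume "\<gamma> \<in> B m"
      then obtain y ys where "\<gamma> = y # ys" by (cases \<gamma>) (auto simp: B_def)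
      then show "p (hd \<gamma>) * ?w \<gamma> = (\<Sum>x | E x (hd \<gamma>). p x * ?w (x # \<gamma>))"
        by (subst inv) (simp add: sum_distrib_right mult.assoc)
    qed
    also have "\<dots> = sum ?h ?Z" using finB by (subst sum.Sigma) auto
    also have "\<dots> = (\<Sum>\<gamma>\<in>?c ` ?Z. p (hd \<gamma>) * ?w \<gamma>)"
      by (subst sum.reindex) (auto simp: inj_on_def intro!: sum.cong)
    also have "?c ` ?Z = {\<gamma>\<in>excursions E s t. length \<gamma> = Suc (Suc m)} \<union> B (Suc m)"
    proof (intro equalityI subsetI)
      fix \<delta> assume "\<delta> \<in> ?c ` ?Z"
      then show "\<delta> \<in> {\<gamma>\<in>excursions E s t. length \<gamma> = Suc (Suc m)} \<union> B (Suc m)"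
        by (auto simp: excursions_def B_def successively_Cons split: if_splits)
    next
      fix \<delta> assume d: "\<delta> \<in> {\<gamma>\<in>excursions E s t. length \<gamma> = Suc (Suc m)} \<union> B (Suc m)"
      then obtain x \<gamma> where "\<delta> = x # \<gamma>" "\<gamma> \<noteq> []"
        by (force simp: excursions_def B_def length_Suc_conv)
      with d have "\<gamma> \<in> B m" "E x (hd \<gamma>)"
        by (auto simp: excursions_def B_def successively_Cons)
      with \<open>\<delta> = x # \<gamma>\<close> show "\<delta> \<in> ?c ` ?Z"
        by (intro image_eqI[of _ _ "(\<gamma>, x)"]) auto
    qed
    also have "(\<Sum>\<gamma>\<in>\<dots>. p (hd \<gamma>) * ?w \<gamma>) =
        (\<Sum>\<gamma> | \<gamma> \<in> excursions E s t \<and> length \<gamma> = Suc (Suc m). p (hd \<gamma>) * ?w \<gamma>) + R (Suc m)"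
      unfolding R_def
    proof (rule sum.union_disjoint)
      show "finite {\<gamma>\<in>excursions E s t. length \<gamma> = Suc (Suc m)}"
        by (rule finite_subset[OF _ finite_lists_length_le[of UNIV "Suc (Suc m)"]]) auto
      show "{\<gamma>\<in>excursions E s t. length \<gamma> = Suc (Suc m)} \<inter> B (Suc m) = {}"
      proof -
        have "hd \<gamma> \<in> set (butlast \<gamma>)" if "length \<gamma> = Suc (Suc m)" for \<gamma> :: "'v list"
          using that by (cases \<gamma>; cases "tl \<gamma>") auto
        then show ?thesis by (auto simp: excursions_def B_def)
      qed
    qed (rule finB)
    also have "(\<Sum>\<gamma> | \<gamma> \<in> excursions E s t \<and> length \<gamma> = Suc (Suc m). p (hd \<gamma>) * ?w \<gamma>) =
        p s * sum ?w {\<gamma>\<in>excursions E s t. length \<gamma> = Suc (Suc m)}"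
      unfolding sum_distrib_left by (rule sum.cong) (auto simp: excursions_def)
    finally show ?thesis .
  qed
  have partial: "p t = (\<Sum>\<gamma>\<in>?X (Suc m). p s * ?w \<gamma>) + R m" for m
  proof (induction m)
    case 0
    have "B 0 = {[t]}" by (auto simp: B_def length_Suc_conv)
    moreover have "?X (Suc 0) = {}" by (auto simp: excursions_def)
    ultimately show ?case by (simp only: R_def) simp
  next
    case (Suc m)
    have "?X (Suc (Suc m)) = ?X (Suc m) \<union> {\<gamma>\<in>excursions E s t. length \<gamma> = Suc (Suc m)}" by auto
    moreover have "finite {\<gamma>\<in>excursions E s t. length \<gamma> = Suc (Suc m)}"
      by (rule finite_subset[OF _ finite_lists_length_le[of UNIV "Suc (Suc m)"]]) auto
    ultimately have "(\<Sum>\<gamma>\<in>?X (Suc (Suc m)). p s * ?w \<gamma>) = (\<Sum>\<gamma>\<in>?X (Suc m). p s * ?w \<gamma>) +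
        (\<Sum>\<gamma>\<in>{\<gamma>\<in>excursions E s t. length \<gamma> = Suc (Suc m)}. p s * ?w \<gamma>)"
      by (simp only:) (rule sum.union_disjoint, auto)
    then show ?case using Suc.IH step[of m] by (simp add: sum_distrib_left)
  qed
  have "R \<longlonglongrightarrow> 0"
  proof -
    define P where "P = {\<gamma>. successively E \<gamma> \<and> s \<notin> set (butlast (tl \<gamma>)) \<and>
      (s \<notin> set (butlast \<gamma>) \<and> last \<gamma> = t)}"
    have e: "loop_erasable P"
      by (rule loop_erasable_classI[OF P_def]) (auto simp: butlast_append)
    define r where "r m = sum ?w (B m)" for m
    have BP: "B m \<subseteq> P" for m by (auto simp: B_def P_def dest: in_set_butlastD)
       (metis butlast_tl in_set_butlastD list.set_sel(2) tl_Nil)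
    have nnP: "0 \<le> ?w \<gamma>" if "\<gamma> \<in> P" for \<gamma> using that by (auto simp: P_def intro: walk_nonneg)
    have rn: "0 \<le> r m" for m unfolding r_def using BP nnP by (intro sum_nonneg) blast
    have "summable r"
    proof (rule summableI_nonneg_bounded[OF rn])
      fix m
      have "(\<Sum>i<m. r i) = sum ?w (\<Union>i<m. B i)"
        unfolding r_def by (rule sum.UNION_disjoint[symmetric]) (use finB in \<open>auto simp: B_def\<close>)
      also have "\<dots> \<le> sum ?w {\<gamma>. \<gamma> \<in> P \<and> length \<gamma> \<le> m}"
        by (rule sum_mono2) (use BP nnP in \<open>auto simp: B_def\<close>)
      also have "\<dots> \<le> 2 * (\<Sum>\<gamma> | \<gamma> \<in> P \<and> length \<gamma> \<le> short TYPE('v). ?w \<gamma>)"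
        by (rule short_walks_dominate[OF e])
      finally show "(\<Sum>i<m. r i) \<le> 2 * (\<Sum>\<gamma> | \<gamma> \<in> P \<and> length \<gamma> \<le> short TYPE('v). ?w \<gamma>)" .
    qed
    then have "r \<longlonglongrightarrow> 0" by (rule summable_LIMSEQ_zero)
    then have lim: "(\<lambda>m. (\<Sum>x\<in>UNIV. \<bar>p x\<bar>) * r m) \<longlonglongrightarrow> 0"
      by (rule tendsto_mult_right_zero)
    show ?thesis
    proof (rule Lim_null_comparison[OF _ lim], intro always_eventually allI)
      fix m
      have "\<bar>R m\<bar> \<le> (\<Sum>\<gamma>\<in>B m. \<bar>p (hd \<gamma>)\<bar> * ?w \<gamma>)"
        unfolding R_def by (rule order_trans[OF sum_abs])
          (use BP nnP in \<open>auto intro!: sum_mono simp: abs_mult subset_eq\<close>)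
      also have "\<dots> \<le> (\<Sum>\<gamma>\<in>B m. (\<Sum>x\<in>UNIV. \<bar>p x\<bar>) * ?w \<gamma>)"
        using BP nnP by (intro sum_mono mult_right_mono member_le_sum[where f = "\<lambda>x. \<bar>p x\<bar>"]) auto
      finally show "norm (R m) \<le> (\<Sum>x\<in>UNIV. \<bar>p x\<bar>) * r m"
        by (simp add: r_def sum_distrib_left)
    qed
  qed
  then have "(\<lambda>m. p t - R m) \<longlonglongrightarrow> p t - 0" by (intro tendsto_diff tendsto_const)
  also have "(\<lambda>m. p t - R m) = (\<lambda>m. \<Sum>\<gamma>\<in>?X (Suc m). p s * ?w \<gamma>)"
    using partial by (auto simp: algebra_simps)
  finally have lim: "(\<lambda>m. \<Sum>\<gamma>\<in>?X m. p s * ?w \<gamma>) \<longlonglongrightarrow> p t"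
    by (subst (asm) filterlim_sequentially_Suc) simp
  show ?thesis using ps
    by (intro has_sum_by_length[OF _ lim]) (auto simp: excursions_def intro!: mult_nonneg_nonneg walk_nonneg)
qed

end

section \<open>Damped sums and their derivative\<close>

text \<open>For the list of inverse rates 1/a along a walk this is the ratio of its weights at
  \<open>t\<close> and at 0, because k/(a+t) = (k/a) / (1+t/a).\<close>

definition damping :: "real \<Rightarrow> real list \<Rightarrow> real" where
  "damping t rs = prod_list (map (\<lambda>r. 1 / (1 + t * r)) rs)"

lemma damping_simps [simp]:
  "damping t [] = 1" "damping t (r # rs) = 1 / (1 + t * r) * damping t rs" "damping 0 rs = 1"
  by (simp_all add: damping_def map_replicate_const)

lemma damping_nonneg:
  assumes "\<And>r. r \<in> set rs \<Longrightarrow> 0 < 1 + t * r"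
  shows "0 \<le> damping t rs"
  using assms by (induction rs) (auto simp: less_imp_le)

lemma damping_antimono:
  assumes "\<And>r. r \<in> set rs \<Longrightarrow> 0 \<le> r \<and> 0 < 1 + t * r" and "t \<le> u"
  shows "damping u rs \<le> damping t rs"
  using assms(1)
proof (induction rs)
  case (Cons r rs)
  have r: "0 \<le> r" "0 < 1 + t * r" using Cons.prems by auto
  have tu: "1 + t * x \<le> 1 + u * x" if "0 \<le> x" for x using assms(2) that by (simp add: mult_right_mono)
  have "0 < 1 + u * x" if "x \<in> set rs" for x
  proof -
    have "0 \<le> x" "0 < 1 + t * x" using Cons.prems that by auto
    with tu[OF \<open>0 \<le> x\<close>] show ?thesis by linarith
  qed
  then have "0 \<le> damping u rs" by (rule damping_nonneg)
  moreover have "1 / (1 + u * r) \<le> 1 / (1 + t * r)"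
    by (rule frac_le[OF _ _ r(2) tu[OF r(1)]]) simp_all
  moreover have "damping u rs \<le> damping t rs" using Cons by simp
  ultimately show ?case
    unfolding damping_simps using divide_nonneg_pos[OF zero_le_one r(2)] by (intro mult_mono)
qed simp

text \<open>The tangent at 0 of a convex function; each induction step gives away the nonnegative
  term \<open>t\<^sup>2 * (r * (r + sum_list rs))\<close>. Negative \<open>t\<close> is allowed
  while all factors are positive, which is used at the left end of an interval around 0.\<close>

lemma damping_ge_linear:
  assumes "\<And>r. r \<in> set rs \<Longrightarrow> 0 \<le> r \<and> 0 < 1 + t * r"
  shows "1 - t * sum_list rs \<le> damping t rs"
  using assms
proof (induction rs)
  case (Cons r rs)
  have r: "0 \<le> r" "0 < 1 + t * r" using Cons.prems by auto
  have S: "0 \<le> sum_list rs" using Cons.prems by (intro sum_list_nonneg) auto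
  have "(1 + t * r) * (1 - t * (r + sum_list rs)) = 1 - t * sum_list rs - t\<^sup>2 * (r * (r + sum_list rs))"
    by (simp add: algebra_simps power2_eq_square)
  also have "\<dots> \<le> damping t rs"
  proof -
    have "0 \<le> t\<^sup>2 * (r * (r + sum_list rs))" using r S by simp
    with Cons show ?thesis by fastforce
  qed
  finally show ?case using r by (simp add: pos_le_divide_eq mult.commute)
qed simp

text \<open>Expanding the product of the \<open>1 + t * r\<close> and keeping the terms up to first
  order gives the bound opposite to the tangent: a guaranteed decrease for
  \<open>t \<ge> 0\<close>.\<close>

lemma damping_le_hyperbolic:
  assumes "\<And>r. r \<in> set rs \<Longrightarrow> 0 \<le> r" "0 \<le> t"
  shows "damping t rs * (1 + t * sum_list rs) \<le> 1"
  using assms(1)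
proof (induction rs)
  case (Cons r rs)
  have r: "0 \<le> t * r" using Cons.prems assms(2) by simp
  have S: "0 \<le> t * sum_list rs" using Cons.prems assms(2) by (intro mult_nonneg_nonneg sum_list_nonneg) auto
  have rs: "0 \<le> t * x" if "x \<in> set rs" for x using that Cons.prems assms(2) by simp
  have d: "0 \<le> damping t rs" by (rule damping_nonneg) (use rs in fastforce)
  have "damping t rs * (1 + t * (r + sum_list rs)) \<le> damping t rs * ((1 + t * r) * (1 + t * sum_list rs))"
    using mult_nonneg_nonneg[OF r S] by (intro mult_left_mono d) (simp add: algebra_simps)
  also have "\<dots> = (1 + t * r) * (damping t rs * (1 + t * sum_list rs))" by simp
  also have "\<dots> \<le> (1 + t * r) * 1"
    using Cons r by (intro mult_left_mono) auto
  finally show ?case using r by (simp add: pos_divide_le_eq)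
qed simp

text \<open>The Taylor coefficients of \<open>damping (- t)\<close> are nonnegative, so its remainder after the linear
  term, divided by \<open>t\<^sup>2\<close>, is largest at the left end of the interval.\<close>

lemma damping_remainder:
  assumes "\<And>r. r \<in> set rs \<Longrightarrow> 0 \<le> r \<and> h * r < 1" and t: "\<bar>t\<bar> \<le> h"
  shows "h\<^sup>2 * (damping t rs - 1 + t * sum_list rs) \<le> t\<^sup>2 * (damping (- h) rs - 1 - h * sum_list rs)"
  using assms(1)
proof (induction rs)
  case (Cons r rs)
  let ?S = "sum_list rs"
  let ?A = "damping t rs - 1 + t * ?S" and ?B = "damping (- h) rs - 1 - h * ?S"
  have r: "0 \<le> r" "0 < 1 - h * r" using Cons.prems[of r] by auto
  have S: "0 \<le> ?S" using Cons.prems by (intro sum_list_nonneg) auto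
  have B: "0 \<le> ?B" using damping_ge_linear[of rs "-h"] Cons.prems by force
  have "- h * r \<le> t * r" using t r by (intro mult_right_mono) auto
  then have le: "1 - h * r \<le> 1 + t * r" by simp
  have eq: "damping u (r # rs) - 1 + u * sum_list (r # rs) =
      ((damping u rs - 1 + u * ?S) + u\<^sup>2 * (r * (r + ?S))) / (1 + u * r)" if "0 < 1 + u * r" for u
    using that by (simp add: field_simps power2_eq_square)
  have "h\<^sup>2 * (damping t (r # rs) - 1 + t * sum_list (r # rs)) =
      (h\<^sup>2 * ?A + t\<^sup>2 * (h\<^sup>2 * (r * (r + ?S)))) / (1 + t * r)"
    using le r(2) by (subst eq) (auto simp: algebra_simps)
  also have "\<dots> \<le> (t\<^sup>2 * ?B + t\<^sup>2 * (h\<^sup>2 * (r * (r + ?S)))) / (1 + t * r)"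
  proof (rule divide_right_mono)
    show "h\<^sup>2 * ?A + t\<^sup>2 * (h\<^sup>2 * (r * (r + ?S))) \<le> t\<^sup>2 * ?B + t\<^sup>2 * (h\<^sup>2 * (r * (r + ?S)))"
      using Cons by simp
    show "0 \<le> 1 + t * r" using le r(2) by linarith
  qed
  also have "\<dots> \<le> (t\<^sup>2 * ?B + t\<^sup>2 * (h\<^sup>2 * (r * (r + ?S)))) / (1 - h * r)"
    using le r S B by (intro divide_left_mono add_nonneg_nonneg mult_nonneg_nonneg mult_pos_pos) auto
  also have "\<dots> = t\<^sup>2 * (damping (- h) (r # rs) - 1 - h * sum_list (r # rs))"
    using eq[of "- h"] r(2) by (simp add: algebra_simps)
  finally show ?case .
qed simp

text \<open>Summability at the single point \<open>- h\<close> controls everything: the terms there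
  dominate those at all \<open>t \<ge> - h\<close>, and by \<open>damping_remainder\<close> the
  error of the linear approximation, summed over \<open>X\<close>, is at most a constant times the
  square of \<open>t\<close>.\<close>

lemma damped_sum_derivative:
  fixes w :: "'a \<Rightarrow> real"
  assumes h: "0 < h" and w: "\<And>x. x \<in> X \<Longrightarrow> 0 \<le> w x"
    and rs: "\<And>x r. x \<in> X \<Longrightarrow> r \<in> set (rs x) \<Longrightarrow> 0 \<le> r \<and> h * r < 1"
    and sm: "(\<lambda>x. w x * damping (- h) (rs x)) summable_on X"
  shows "(\<lambda>x. w x * sum_list (rs x)) summable_on X"
    and "((\<lambda>t. \<Sum>\<^sub>\<infinity>x\<in>X. w x * damping t (rs x)) has_real_derivative
      - (\<Sum>\<^sub>\<infinity>x\<in>X. w x * sum_list (rs x))) (at 0)"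
proof -
  have pos: "0 < 1 + t * r" if "x \<in> X" "r \<in> set (rs x)" "- h \<le> t" for x r t
  proof -
    have "- h * r \<le> t * r" using rs[OF that(1,2)] that(3) by (intro mult_right_mono) auto
    with rs[OF that(1,2)] show ?thesis by auto
  qed
  have smt: "(\<lambda>x. w x * damping t (rs x)) summable_on X" if "- h \<le> t" for t
  proof (rule summable_on_comparison_test[OF sm])
    fix x assume x: "x \<in> X"
    show "w x * damping t (rs x) \<le> w x * damping (- h) (rs x)"
      using pos[OF x, of _ "- h"] rs[OF x] that by (intro mult_left_mono damping_antimono w x) auto
    show "0 \<le> w x * damping t (rs x)"
      using pos[OF x _ that] by (intro mult_nonneg_nonneg damping_nonneg w x)
  qed
  have sw: "w summable_on X" using smt[of 0] h by simp
  show sS: "(\<lambda>x. w x * sum_list (rs x)) summable_on X"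
  proof (rule summable_on_comparison_test[OF summable_on_cmult_right[OF sm]])
    fix x assume x: "x \<in> X"
    have "1 + h * sum_list (rs x) \<le> damping (- h) (rs x)"
      using damping_ge_linear[of "rs x" "- h"] pos[OF x, of _ "- h"] rs[OF x] by simp
    then have "sum_list (rs x) \<le> 1 / h * damping (- h) (rs x)" using h by (simp add: field_simps)
    from mult_left_mono[OF this w[OF x]]
    show "w x * sum_list (rs x) \<le> 1 / h * (w x * damping (- h) (rs x))" by (simp add: mult_ac)
    show "0 \<le> w x * sum_list (rs x)" using rs[OF x] by (intro mult_nonneg_nonneg w x sum_list_nonneg) auto
  qed
  let ?H = "\<lambda>t. \<Sum>\<^sub>\<infinity>x\<in>X. w x * damping t (rs x)" and ?D = "\<Sum>\<^sub>\<infinity>x\<in>X. w x * sum_list (rs x)"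
  let ?E = "\<lambda>t x. w x * (damping t (rs x) - 1 + t * sum_list (rs x))"
  have bound: "\<bar>?H t - ?H 0 + t * ?D\<bar> \<le> t\<^sup>2 / h\<^sup>2 * ?H (- h)" if t: "\<bar>t\<bar> \<le> h" for t
  proof -
    have sE: "?E t summable_on X" and eq: "infsum (?E t) X = ?H t - ?H 0 + t * ?D"
    proof -
      have t': "- h \<le> t" using t by simp
      have "((\<lambda>x. w x * damping t (rs x) + (- 1) * w x + t * (w x * sum_list (rs x))) has_sum
          ?H t + (- 1) * infsum w X + t * ?D) X"
        using smt[OF t'] sw sS by (intro has_sum_add has_sum_cmult_right) auto
      then have "(?E t has_sum ?H t - ?H 0 + t * ?D) X" by (simp add: algebra_simps)
      then show "?E t summable_on X" "infsum (?E t) X = ?H t - ?H 0 + t * ?D"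
        by (auto simp: infsumI summable_on_def)
    qed
    have E0: "0 \<le> ?E t x" if x: "x \<in> X" for x
      using damping_ge_linear[of "rs x" t] pos[OF x, of _ t] rs[OF x] t
      by (intro mult_nonneg_nonneg w x) force
    have "?E t x \<le> t\<^sup>2 / h\<^sup>2 * (w x * damping (- h) (rs x))" if x: "x \<in> X" for x
    proof -
      have "0 \<le> 1 + h * sum_list (rs x)"
        using rs[OF x] h by (intro add_nonneg_nonneg mult_nonneg_nonneg sum_list_nonneg) auto
      then have "t\<^sup>2 * (damping (- h) (rs x) - 1 - h * sum_list (rs x)) \<le> t\<^sup>2 * damping (- h) (rs x)"
        by (intro mult_left_mono) auto
      with damping_remainder[of "rs x" h t] rs[OF x] t
      have "h\<^sup>2 * (damping t (rs x) - 1 + t * sum_list (rs x)) \<le> t\<^sup>2 * damping (- h) (rs x)" by force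
      then have "damping t (rs x) - 1 + t * sum_list (rs x) \<le> t\<^sup>2 / h\<^sup>2 * damping (- h) (rs x)"
        using h by (simp add: field_simps)
      from mult_left_mono[OF this w[OF x]] show ?thesis by (simp add: mult_ac)
    qed
    then have "infsum (?E t) X \<le> (\<Sum>\<^sub>\<infinity>x\<in>X. t\<^sup>2 / h\<^sup>2 * (w x * damping (- h) (rs x)))"
      by (intro infsum_mono sE summable_on_cmult_right sm)
    also have "\<dots> = t\<^sup>2 / h\<^sup>2 * ?H (- h)" by (intro infsum_cmult_right sm)
    finally show ?thesis using infsum_nonneg[of X "?E t"] E0 eq by simp
  qed

  have ev: "\<forall>\<^sub>F t in at 0. \<bar>(?H (0 + t) - ?H 0) / t + ?D\<bar> \<le> \<bar>t\<bar> * (?H (- h) / h\<^sup>2)"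
    unfolding eventually_at
  proof (intro exI[of _ h] conjI h ballI impI)
    fix t :: real assume t: "t \<noteq> 0 \<and> dist t 0 < h"
    have "\<bar>(?H (0 + t) - ?H 0) / t + ?D\<bar> = \<bar>?H t - ?H 0 + t * ?D\<bar> / \<bar>t\<bar>"
      unfolding abs_divide[symmetric] using t by (simp add: field_simps)
    also have "\<dots> \<le> (t\<^sup>2 / h\<^sup>2 * ?H (- h)) / \<bar>t\<bar>"
      using t by (intro divide_right_mono bound) auto
    also have "\<dots> = \<bar>t\<bar> * (?H (- h) / h\<^sup>2)"
      using t by (cases "0 \<le> t") (simp_all add: power2_eq_square)
    finally show "\<bar>(?H (0 + t) - ?H 0) / t + ?D\<bar> \<le> \<bar>t\<bar> * (?H (- h) / h\<^sup>2)" .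
  qed
  have "((\<lambda>t::real. \<bar>t\<bar> * (?H (- h) / h\<^sup>2)) \<longlongrightarrow> 0) (at 0)"
    by (intro tendsto_mult_left_zero tendsto_rabs_zero tendsto_ident_at)
  then have "((\<lambda>t. (?H (0 + t) - ?H 0) / t + ?D) \<longlongrightarrow> 0) (at 0)"
    by (rule Lim_null_comparison[rotated]) (use ev in simp)
  from tendsto_diff[OF this tendsto_const[of ?D]]
  show "(?H has_real_derivative - ?D) (at 0)"
    unfolding DERIV_def by simp
qed

section \<open>Rates and scales of a network\<close>

lemma trans_rate_nonneg:
  assumes "wf_network N" "1 < b" "\<sigma> \<noteq> \<tau>"
  shows "0 \<le> trans_rate N b \<sigma> \<tau>"
  unfolding trans_rate_eq[OF assms(3)] using assms
  by (intro sum_nonneg mult_nonneg_nonneg) (auto simp: wf_network_def intro: order_trans[OF zero_le_one])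

lemma trans_rate_eq_0:
  assumes "wf_network N" "1 < b" "\<sigma> \<noteq> \<tau>" "\<not> edge N \<sigma> \<tau>"
  shows "trans_rate N b \<sigma> \<tau> = 0"
  using trans_rate_nonneg[OF assms(1-3)] edge_iff[OF assms(1,2)] assms(3,4) by fastforce

text \<open>No product equals its reactant, so the diagonal collects only the losses, and every
  product of a reaction is counted in an off-diagonal entry of the same column.\<close>

lemma sum_reaction_rates:
  fixes N :: "('r, 'v::finite) network"
  assumes "wf_network N"
  shows "generator N b $ \<sigma> $ \<sigma> = - (\<Sum>\<rho> | \<rho> \<in> reactions N \<and> reactant N \<rho> = \<sigma>. reaction_rate N b \<rho>)"
    and "out_rate N b \<sigma> = (\<Sum>\<rho> | \<rho> \<in> reactions N \<and> reactant N \<rho> = \<sigma>.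
      real (size (products N \<rho>)) * reaction_rate N b \<rho>)"
proof -
  let ?R = "{\<rho>. \<rho> \<in> reactions N \<and> reactant N \<rho> = \<sigma>}"
  have c0: "count (products N \<rho>) \<sigma> = 0" if "\<rho> \<in> ?R" for \<rho>
    using that assms by (auto simp: wf_network_def not_in_iff)
  show "generator N b $ \<sigma> $ \<sigma> = - sum (reaction_rate N b) ?R"
    using c0 by (simp add: generator_def sum_negf)
  have size: "real (size M) = (\<Sum>\<tau>\<in>UNIV - {\<sigma>}. real (count M \<tau>))" if "count M \<sigma> = 0" for M :: "'v multiset"
  proof -
    have "size M = (\<Sum>\<tau>\<in>UNIV - {\<sigma>}. count M \<tau>)"
      unfolding size_multiset_overloaded_eq
      by (rule sum.mono_neutral_left) (use that in \<open>auto simp: not_in_iff[symmetric] count_eq_zero_iff\<close>)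
    then show ?thesis by simp
  qed
  have "out_rate N b \<sigma> = (\<Sum>\<tau>\<in>UNIV - {\<sigma>}. \<Sum>\<rho>\<in>?R. real (count (products N \<rho>) \<tau>) * reaction_rate N b \<rho>)"
    unfolding out_rate_def reaction_rate_def by (intro sum.cong trans_rate_eq) auto
  also have "\<dots> = (\<Sum>\<rho>\<in>?R. \<Sum>\<tau>\<in>UNIV - {\<sigma>}. real (count (products N \<rho>) \<tau>) * reaction_rate N b \<rho>)"
    by (rule sum.swap)
  also have "\<dots> = (\<Sum>\<rho>\<in>?R. real (size (products N \<rho>)) * reaction_rate N b \<rho>)"
    by (intro sum.cong refl) (simp only: size[OF c0] sum_distrib_right)
  finally show "out_rate N b \<sigma> = (\<Sum>\<rho>\<in>?R. real (size (products N \<rho>)) * reaction_rate N b \<rho>)" .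
qed

section \<open>Comparison of rates, power laws in the base, and smallness of loops\<close>

locale irreducible_network =
  fixes N :: "('r, 'v::finite) network"
  assumes wf: "wf_network N" and card: "CARD('v) \<ge> 2" and connected: "strongly_connected N"
begin

lemma ex_edge: "\<exists>\<tau>. edge N \<sigma> \<tau>"
proof -
  obtain \<tau> where "\<tau> \<noteq> \<sigma>"
    using card by (metis (full_types) UNIV_I card_2_iff' card_le_Suc0_iff_eq finite not_less_eq_eq numeral_2_eq_2)
  moreover have "(edge N)\<^sup>*\<^sup>* \<sigma> \<tau>" using connected by (simp add: strongly_connected_def)
  ultimately show ?thesis by (auto elim: converse_rtranclpE)
qed

lemma trans_rate_le_out_rate:
  assumes "1 < b" "\<sigma> \<noteq> \<tau>"
  shows "trans_rate N b \<sigma> \<tau> \<le> out_rate N b \<sigma>"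
  unfolding out_rate_def using assms trans_rate_nonneg[OF wf]
  by (intro member_le_sum[where f = "trans_rate N b \<sigma>"]) auto

text \<open>A reaction enters \<open>diag_rate\<close> once and \<open>out_rate\<close> once per
  product, that is, once or twice. Hence the two rates agree within a factor 2, whatever the
  base.\<close>

lemma rates:
  assumes b: "1 < b"
  shows "0 < diag_rate N b \<sigma>" "0 < out_rate N b \<sigma>" "diag_rate N b \<sigma> \<le> out_rate N b \<sigma>"
    "out_rate N b \<sigma> \<le> 2 * diag_rate N b \<sigma>" "generator N b $ \<sigma> $ \<sigma> = - diag_rate N b \<sigma>"
    "1 + rel_growth N b \<sigma> = out_rate N b \<sigma> / diag_rate N b \<sigma>"
proof -
  let ?R = "{\<rho>. \<rho> \<in> reactions N \<and> reactant N \<rho> = \<sigma>}"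
  have size: "size (products N \<rho>) \<in> {1, 2}" "0 \<le> reaction_rate N b \<rho>" if "\<rho> \<in> ?R" for \<rho>
    using that b wf by (auto simp: wf_network_def reaction_rate_def intro!: mult_nonneg_nonneg intro: order_trans[OF zero_le_one])
  have d: "diag_rate N b \<sigma> = sum (reaction_rate N b) ?R"
    unfolding diag_rate_def sum_reaction_rates(1)[OF wf] using sum_nonneg[of ?R "reaction_rate N b"] size(2) by simp
  show gd: "generator N b $ \<sigma> $ \<sigma> = - diag_rate N b \<sigma>" by (simp add: d sum_reaction_rates(1)[OF wf])
  show "diag_rate N b \<sigma> \<le> out_rate N b \<sigma>"
    unfolding d sum_reaction_rates(2)[OF wf]
    by (rule sum_mono) (use size in \<open>force intro: mult_right_mono[of 1, simplified]\<close>)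
  show od: "out_rate N b \<sigma> \<le> 2 * diag_rate N b \<sigma>"
    unfolding d sum_reaction_rates(2)[OF wf] sum_distrib_left
    by (rule sum_mono, rule mult_right_mono) (use size in force)+
  obtain \<tau> where "edge N \<sigma> \<tau>" using ex_edge by blast
  then have "0 < trans_rate N b \<sigma> \<tau>" "\<sigma> \<noteq> \<tau>" using b by (auto simp: edge_def)
  with trans_rate_le_out_rate[OF b] show op: "0 < out_rate N b \<sigma>" by fastforce
  with od show dp: "0 < diag_rate N b \<sigma>" by linarith
  have "growth_rate N b \<sigma> = generator N b $ \<sigma> $ \<sigma> + out_rate N b \<sigma>"
    unfolding growth_rate_def out_rate_def trans_rate_def by (rule sum.remove) auto
  with dp gd show "1 + rel_growth N b \<sigma> = out_rate N b \<sigma> / diag_rate N b \<sigma>"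
    by (simp add: rel_growth_def field_simps)
qed

text \<open>The scale is the largest exponent among the reactions behind the edge, and coefficients
  of at least 1 make the lower constant 1. Unlike the floor of the logarithm, these bounds are
  available for every \<open>b > 1\<close>, with \<open>C\<close> independent of
  \<open>b\<close>.\<close>

lemma trans_rate_scale:
  assumes e: "edge N \<sigma> \<tau>"
  obtains C where "1 \<le> C" "\<And>b. 1 < b \<Longrightarrow> b powi edge_scale N \<sigma> \<tau> \<le> trans_rate N b \<sigma> \<tau>"
    "\<And>b. 1 < b \<Longrightarrow> trans_rate N b \<sigma> \<tau> \<le> C * b powi edge_scale N \<sigma> \<tau>"
proof -
  let ?R = "{\<rho>. \<rho> \<in> reactions N \<and> reactant N \<rho> = \<sigma> \<and> \<tau> \<in># products N \<rho>}"
  let ?c = "\<lambda>\<rho>. real (count (products N \<rho>) \<tau>) * rate_coeff N \<rho>"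
  define m where "m = Max (rate_expo N ` ?R)"
  define C where "C = sum ?c ?R"
  have ne: "\<sigma> \<noteq> \<tau>" using e by (simp add: edge_def)
  have fin: "finite ?R" "finite {\<rho>. \<rho> \<in> reactions N \<and> reactant N \<rho> = \<sigma>}"
    using wf by (simp_all add: wf_network_def)
  have k: "trans_rate N b \<sigma> \<tau> = (\<Sum>\<rho>\<in>?R. ?c \<rho> * b powi rate_expo N \<rho>)" for b
    unfolding trans_rate_eq[OF ne]
    by (rule sum.mono_neutral_cong_right[OF fin(2)]) (auto simp: not_in_iff)
  have "0 < trans_rate N 2 \<sigma> \<tau>" using e by (simp add: edge_def)
  then have "?R \<noteq> {}" unfolding k by (metis (no_types, lifting) less_irrefl sum.empty)
  then have "m \<in> rate_expo N ` ?R" unfolding m_def using fin(1) by (intro Max_in) auto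
  then obtain \<rho> where r: "\<rho> \<in> ?R" "rate_expo N \<rho> = m" by blast
  have c1: "1 \<le> ?c \<rho>" if "\<rho> \<in> ?R" for \<rho>
  proof -
    have "1 \<le> real (count (products N \<rho>) \<tau>)" using that by (auto simp: Suc_le_eq)
    moreover have "1 \<le> rate_coeff N \<rho>" using that wf by (auto simp: wf_network_def)
    ultimately show ?thesis by (metis mult_mono mult_1 zero_le_one order_trans)
  qed
  have lower: "b powi m \<le> trans_rate N b \<sigma> \<tau>" if "1 < b" for b
  proof -
    have "1 * b powi m \<le> ?c \<rho> * b powi m"
      using c1[OF r(1)] that by (intro mult_right_mono) auto
    also have "\<dots> \<le> trans_rate N b \<sigma> \<tau>"
      unfolding k r(2)[symmetric]
    proof (rule member_le_sum[OF r(1) _ fin(1)])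
      fix \<rho>' assume "\<rho>' \<in> ?R - {\<rho>}"
      then have "0 \<le> ?c \<rho>'" using c1[of \<rho>'] by force
      then show "0 \<le> ?c \<rho>' * b powi rate_expo N \<rho>'"
        using mult_nonneg_nonneg[of "?c \<rho>'" "b powi rate_expo N \<rho>'"] that by simp
    qed
    finally show ?thesis by simp
  qed
  have upper: "trans_rate N b \<sigma> \<tau> \<le> C * b powi m" if "1 < b" for b
    unfolding k C_def sum_distrib_right
  proof (rule sum_mono)
    fix \<rho>' assume r': "\<rho>' \<in> ?R"
    then have "rate_expo N \<rho>' \<le> m" unfolding m_def using fin(1) by (intro Max_ge) auto
    with c1[OF r'] that show "?c \<rho>' * b powi rate_expo N \<rho>' \<le> ?c \<rho>' * b powi m"
      by (intro mult_left_mono power_int_increasing) auto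
  qed
  \<comment> \<open>The identity does not involve \<open>b\<close>, so it suffices to derive it for
    large \<open>b\<close>.\<close>
  have "\<forall>\<^sub>F b::real in at_top. edge_scale N \<sigma> \<tau> = m"
    using eventually_edge_scale[OF wf e] eventually_gt_at_top[of "max 1 C"]
  proof eventually_elim
    case (elim b)
    then have b: "1 < b" "C < b" by auto
    have pos: "0 < trans_rate N b \<sigma> \<tau>" using e b by (auto simp: edge_def)
    have "C * b powi m < b * b powi m" using b by (intro mult_strict_right_mono) auto
    also have "\<dots> = b powi (m + 1)" using b by (simp add: power_int_add)
    finally have "trans_rate N b \<sigma> \<tau> < b powi (m + 1)" using upper[OF b(1)] by simp
    then have "log b (trans_rate N b \<sigma> \<tau>) < real_of_int (m + 1)"
      using b pos by (simp add: log_less_iff powr_real_of_int' del: of_int_add)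
    moreover have "real_of_int m \<le> log b (trans_rate N b \<sigma> \<tau>)"
      using lower[OF b(1)] b pos by (simp add: le_log_iff powr_real_of_int')
    ultimately have "\<lfloor>log b (trans_rate N b \<sigma> \<tau>)\<rfloor> = m" by (simp add: floor_eq_iff)
    with elim(1) show ?case by simp
  qed
  then have "edge_scale N \<sigma> \<tau> = m" by simp
  moreover have "1 \<le> C"
    using c1[OF r(1)] member_le_sum[OF r(1), of ?c] c1 fin(1) unfolding C_def
    by (meson DiffD1 order_trans zero_le_one)
  ultimately show thesis using lower upper that by blast
qed

lemma out_rate_ge_scale:
  assumes "1 < b"
  shows "b powi vertex_scale N \<sigma> \<le> out_rate N b \<sigma>"
proof -
  have "vertex_scale N \<sigma> \<in> edge_scale N \<sigma> ` {\<tau>. edge N \<sigma> \<tau>}"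
    unfolding vertex_scale_def using ex_edge by (intro Max_in) auto
  then obtain \<tau> where t: "edge N \<sigma> \<tau>" "vertex_scale N \<sigma> = edge_scale N \<sigma> \<tau>" by blast
  then have "b powi vertex_scale N \<sigma> \<le> trans_rate N b \<sigma> \<tau>"
    using trans_rate_scale[OF t(1)] assms by metis
  also have "\<dots> \<le> out_rate N b \<sigma>"
    using t(1) assms by (intro trans_rate_le_out_rate) (auto simp: edge_def)
  finally show ?thesis .
qed

text \<open>Scales are integers, so a non-dominant edge loses at least one full power of
  \<open>b\<close>.\<close>

lemma subdominant_ratio_tendsto_0:
  assumes e: "edge N \<sigma> \<tau>" and ne: "edge_scale N \<sigma> \<tau> \<noteq> vertex_scale N \<sigma>"
  shows "((\<lambda>b. trans_rate N b \<sigma> \<tau> / out_rate N b \<sigma>) \<longlongrightarrow> 0) at_top"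
proof -
  obtain C where C: "1 \<le> C" "\<And>b. 1 < b \<Longrightarrow> trans_rate N b \<sigma> \<tau> \<le> C * b powi edge_scale N \<sigma> \<tau>"
    using trans_rate_scale[OF e] by metis
  have "edge_scale N \<sigma> \<tau> \<le> vertex_scale N \<sigma>"
    unfolding vertex_scale_def using e by (intro Max_ge) auto
  with ne have lt: "edge_scale N \<sigma> \<tau> \<le> vertex_scale N \<sigma> - 1" by simp
  have ev: "\<forall>\<^sub>F b in at_top. norm (trans_rate N b \<sigma> \<tau> / out_rate N b \<sigma>) \<le> C * inverse b"
    using eventually_gt_at_top[of 1]
  proof eventually_elim
    case (elim b)
    have "trans_rate N b \<sigma> \<tau> \<le> C * b powi edge_scale N \<sigma> \<tau>" using C(2) elim .
    also have "\<dots> \<le> C * b powi (vertex_scale N \<sigma> - 1)"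
      using elim C(1) lt by (intro mult_left_mono power_int_increasing) auto
    also have "\<dots> = C * inverse b * b powi vertex_scale N \<sigma>"
      using elim by (simp add: power_int_diff field_simps)
    also have "\<dots> \<le> C * inverse b * out_rate N b \<sigma>"
      using elim C(1) out_rate_ge_scale[OF elim] by (intro mult_left_mono) auto
    finally have "trans_rate N b \<sigma> \<tau> \<le> C * inverse b * out_rate N b \<sigma>" .
    moreover have "0 < trans_rate N b \<sigma> \<tau>" using e elim by (auto simp: edge_def)
    ultimately show ?case using rates(2)[OF elim, of \<sigma>] by (simp add: pos_divide_le_eq)
  qed
  have "((\<lambda>b. C * inverse b) \<longlongrightarrow> C * 0) at_top"
    by (intro tendsto_mult tendsto_const tendsto_inverse_0_at_top filterlim_ident)
  then show ?thesis by (intro Lim_null_comparison[OF ev]) simp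
qed

text \<open>The factor 4 leaves room for \<open>k\<^sub>\<sigma> \<le> 2 a\<^sub>\<sigma>\<close> and for negative \<open>\<alpha> \<ge> - a\<^sub>\<sigma> / 2\<close>, which are needed to
  differentiate at 0.\<close>

definition majorant :: "real \<Rightarrow> 'v \<Rightarrow> 'v \<Rightarrow> real" where
  "majorant b \<sigma> \<tau> = 4 * (trans_rate N b \<sigma> \<tau> / out_rate N b \<sigma>)"

lemma majorant_bounds:
  assumes "1 < b" "edge N \<sigma> \<tau>"
  shows "0 \<le> majorant b \<sigma> \<tau>" "majorant b \<sigma> \<tau> \<le> 4"
proof -
  have "\<sigma> \<noteq> \<tau>" using assms(2) by (simp add: edge_def)
  then show "0 \<le> majorant b \<sigma> \<tau>" "majorant b \<sigma> \<tau> \<le> 4"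
    using trans_rate_nonneg[OF wf assms(1)] rates(2)[OF assms(1), of \<sigma>]
      trans_rate_le_out_rate[OF assms(1)] by (auto simp: majorant_def pos_divide_le_eq)
qed

text \<open>A loop avoiding \<open>s\<close> is a cycle that misses \<open>s\<close>, hence not
  dominant: one of its edges has a vanishing ratio, while the other factors are at most 4.\<close>

lemma loop_majorant_tendsto_0:
  assumes dom: "dominant_hypothesis N s" and walk: "s \<notin> set (x # xs)" "successively (edge N) (x # xs @ [x])"
  shows "((\<lambda>b. walk_weight (majorant b) (x # xs @ [x])) \<longlongrightarrow> 0) at_top"
proof -
  let ?\<gamma> = "x # xs @ [x]"
  let ?r = "\<lambda>b i. majorant b (?\<gamma> ! i) (?\<gamma> ! Suc i)"
  have "is_cycle N ?\<gamma>" using walk(2) by (auto simp: is_cycle_def is_path_def)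
  moreover have "s \<notin> set ?\<gamma>" using walk(1) by auto
  ultimately have "\<not> dominant N ?\<gamma>" using dom unfolding dominant_hypothesis_def by blast
  then obtain i where i: "i < length ?\<gamma> - 1"
    "edge_scale N (?\<gamma> ! i) (?\<gamma> ! Suc i) \<noteq> vertex_scale N (?\<gamma> ! i)"
    unfolding dominant_def by blast
  have e: "edge N (?\<gamma> ! j) (?\<gamma> ! Suc j)" if "j < length ?\<gamma> - 1" for j
    using successively_conv_nth walk(2) that by (metis (no_types, lifting) Suc_lessI less_diff_conv Suc_eq_plus1 less_not_refl)
  let ?J = "{..<length ?\<gamma> - 1} - {i}"
  have ev: "\<forall>\<^sub>F b in at_top. norm (walk_weight (majorant b) ?\<gamma>) \<le> ?r b i * (\<Prod>j\<in>?J. 4)"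
    using eventually_gt_at_top[of 1]
  proof eventually_elim
    case (elim b)
    have "walk_weight (majorant b) ?\<gamma> = ?r b i * (\<Prod>j\<in>?J. ?r b j)"
      unfolding walk_weight_conv_prod using i(1) by (intro prod.remove) auto
    also have "\<dots> \<le> ?r b i * (\<Prod>j\<in>?J. 4)"
      using majorant_bounds[OF elim e] i(1) by (intro mult_left_mono prod_mono) auto
    finally have "walk_weight (majorant b) ?\<gamma> \<le> ?r b i * (\<Prod>j\<in>?J. 4)" .
    moreover have "0 \<le> walk_weight (majorant b) ?\<gamma>"
      by (rule walk_weight_mono(1)[where E = "edge N" and W' = "majorant b"])
        (use walk(2) majorant_bounds[OF elim] in auto)
    ultimately show ?case by simp
  qed
  have "((\<lambda>b. ?r b i * (\<Prod>j\<in>?J. 4)) \<longlongrightarrow> 4 * 0 * (\<Prod>j\<in>?J. 4)) at_top"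
    unfolding majorant_def
    by (intro tendsto_mult tendsto_const subdominant_ratio_tendsto_0 e i)
  then show ?thesis by (intro Lim_null_comparison[OF ev]) simp
qed

lemma loop_bound_pos: "0 < loop_bound TYPE('v)"
proof -
  have "({..short TYPE('v)} \<times> {c::'v list. length c \<le> short TYPE('v)}) \<noteq> {}" by (auto intro: exI[of _ "[]"])
  moreover have "finite ({..short TYPE('v)} \<times> {c::'v list. length c \<le> short TYPE('v)})"
    using finite_lists_length_le[of "UNIV :: 'v set"] by simp
  ultimately show ?thesis unfolding loop_bound_def by (simp add: card_gt_0_iff del: card_cartesian_product)
qed

text \<open>There are only finitely many short loops, so one lower bound on the base serves all of
  them.\<close>

lemma eventually_small_loops:
  assumes dom: "dominant_hypothesis N s"
  shows "\<forall>\<^sub>F b in at_top. small_loops (edge N) (majorant b) s"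
proof -
  let ?A = "{\<gamma>::'v list. (\<gamma> \<noteq> [] \<and> s \<notin> set \<gamma> \<and> successively (edge N) (\<gamma> @ [hd \<gamma>])) \<and> length \<gamma> \<le> short TYPE('v)}"
  have "\<forall>\<^sub>F b in at_top. \<forall>\<gamma>\<in>?A. walk_weight (majorant b) (\<gamma> @ [hd \<gamma>]) < loop_bound TYPE('v)"
  proof (rule eventually_ball_finite[OF finite_lists_length_le_UNIV], rule ballI)
    fix \<gamma> assume g: "\<gamma> \<in> ?A"
    then obtain x xs where "\<gamma> = x # xs" by (cases \<gamma>) auto
    then show "\<forall>\<^sub>F b in at_top. walk_weight (majorant b) (\<gamma> @ [hd \<gamma>]) < loop_bound TYPE('v)"
      using order_tendstoD(2)[OF loop_majorant_tendsto_0[OF dom, of x xs] loop_bound_pos] g by auto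
  qed
  then show ?thesis using eventually_gt_at_top[of 1]
  proof eventually_elim
    case (elim b)
    show ?case
    proof
      fix x xs assume l: "s \<notin> set (x # xs)" "successively (edge N) (x # xs @ [x])"
        "length (x # xs) \<le> short TYPE('v)"
      then have "x # xs \<in> ?A" by simp
      from bspec[OF elim(1) this] show "walk_weight (majorant b) (x # xs @ [x]) \<le> loop_bound TYPE('v)"
        by simp
    qed (use majorant_bounds[OF elim(2)] in auto)
  qed
qed

end

section \<open>Network weights as instances of weighted walks\<close>

lemma excursion_conv: "{\<gamma>. excursion N s t \<gamma>} = excursions (edge N) s t"
  by (auto simp: excursion_def excursions_def is_path_def)

lemma weight_conv: "weight N b \<alpha> = walk_weight (edge_weight N b \<alpha>)"
  by (rule ext) (simp add: weight_def walk_weight_conv_prod)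

lemma markov_weight_conv:
  "markov_weight N b = walk_weight (\<lambda>\<sigma> \<tau>. trans_rate N b \<sigma> \<tau> / out_rate N b \<sigma>)"
  by (rule ext) (simp add: markov_weight_def walk_weight_conv_prod)

lemma small_loops_antimono:
  assumes "small_loops E W' s" "\<And>x y. E x y \<Longrightarrow> 0 \<le> W x y \<and> W x y \<le> W' x y"
  shows "small_loops E W s"
proof
  fix x xs assume l: "s \<notin> set (x # xs)" "successively E (x # xs @ [x])"
    "length (x # xs) \<le> short TYPE('a)"
  have "walk_weight W (x # xs @ [x]) \<le> walk_weight W' (x # xs @ [x])"
    by (rule walk_weight_mono(2)[OF l(2)]) (use assms(2) in auto)
  with small_loops.small[OF assms(1) l] show "walk_weight W (x # xs @ [x]) \<le> loop_bound TYPE('a)"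
    by simp
qed (use assms(2) in blast)

lemma small_loops_transpose:
  assumes "small_loops E W s"
  shows "small_loops (\<lambda>x y. E y x) (\<lambda>x y. W y x) s"
proof
  fix x xs assume l: "s \<notin> set (x # xs)" "successively (\<lambda>x y. E y x) (x # xs @ [x])"
    "length (x # xs) \<le> short TYPE('a)"
  have "successively E (rev (x # xs @ [x]))" using l(2) by (simp only: successively_rev)
  then have "successively E (x # rev xs @ [x])" by simp
  then have "walk_weight W (x # rev xs @ [x]) \<le> loop_bound TYPE('a)"
    by (rule small_loops.small[OF assms, rotated]) (use l in auto)
  moreover have "walk_weight (\<lambda>x y. W y x) (rev (x # rev xs @ [x])) = walk_weight W (x # rev xs @ [x])"
    by (rule walk_weight_rev)
  ultimately show "walk_weight (\<lambda>x y. W y x) (x # xs @ [x]) \<le> loop_bound TYPE('a)" by simp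
qed (use small_loops.nonneg[OF assms] in blast)

text \<open>The Markov chain returns to \<open>s\<close> with probability one.
  \<open>invariant_has_sum\<close> sums over predecessors, whereas stochasticity sums over
  successors; so it is applied to the constant vector 1 on the reversed graph, and excursions are
  reversed to come back.\<close>

lemma stochastic_excursions:
  assumes loops: "small_loops E W s" and stoch: "\<And>x. (\<Sum>y | E x y. W x y) = 1"
  shows "(walk_weight W has_sum 1) (excursions E s s)"
proof -
  interpret T: small_loops "\<lambda>x y. E y x" "\<lambda>x y. W y x" s
    by (rule small_loops_transpose[OF loops])
  have rev_in: "rev \<gamma> \<in> excursions E' s s" if "\<gamma> \<in> excursions (\<lambda>x y. E' y x) s s" for E' \<gamma>
  proof -
    have "set (butlast (tl (rev \<gamma>))) = set (butlast (tl \<gamma>))"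
      by (metis butlast_rev butlast_tl rev_rev_ident set_rev)
    with that show ?thesis
      by (auto simp: excursions_def hd_rev last_rev successively_rev)
  qed
  have "bij_betw rev (excursions E s s) (excursions (\<lambda>x y. E y x) s s)"
    by (rule bij_betwI[where g = rev]) (use rev_in[of _ E] rev_in[of _ "\<lambda>x y. E y x"] in auto)
  from has_sum_reindex_bij_betw[OF this, of "walk_weight (\<lambda>x y. W y x)" 1] show ?thesis
    using T.invariant_has_sum[of "\<lambda>_. 1" s] stoch by (simp add: walk_weight_rev)
qed

context irreducible_network
begin

lemma edge_weight_le_majorant:
  assumes "1 < b" "\<And>\<sigma>. - diag_rate N b \<sigma> / 2 \<le> \<alpha>" "edge N \<sigma> \<tau>"
  shows "0 \<le> edge_weight N b \<alpha> \<sigma> \<tau> \<and> edge_weight N b \<alpha> \<sigma> \<tau> \<le> majorant b \<sigma> \<tau>"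
proof -
  note r = rates[OF assms(1), of \<sigma>]
  have k: "0 \<le> trans_rate N b \<sigma> \<tau>"
    using assms(1,3) trans_rate_nonneg[OF wf] by (auto simp: edge_def)
  have "out_rate N b \<sigma> / 4 \<le> diag_rate N b \<sigma> + \<alpha>" "0 < diag_rate N b \<sigma> + \<alpha>"
    using r assms(2)[of \<sigma>] by linarith+
  then have "trans_rate N b \<sigma> \<tau> / (diag_rate N b \<sigma> + \<alpha>) \<le> trans_rate N b \<sigma> \<tau> / (out_rate N b \<sigma> / 4)"
    using k r by (intro divide_left_mono mult_pos_pos) auto
  then show ?thesis using k \<open>0 < diag_rate N b \<sigma> + \<alpha>\<close> by (simp add: edge_weight_def majorant_def mult.commute)
qed

lemma weight_damping:
  assumes "1 < b"
  shows "weight N b t \<gamma> = weight N b 0 \<gamma> * damping t (map (\<lambda>\<sigma>. 1 / diag_rate N b \<sigma>) (butlast \<gamma>))"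
proof -
  have "edge_weight N b t = (\<lambda>\<sigma> \<tau>. edge_weight N b 0 \<sigma> \<tau> * (1 / (1 + t * (1 / diag_rate N b \<sigma>))))"
  proof (intro ext)
    fix \<sigma> \<tau>
    have "diag_rate N b \<sigma> + t = diag_rate N b \<sigma> * (1 + t * (1 / diag_rate N b \<sigma>))"
      using rates(1)[OF assms, of \<sigma>] by (simp add: field_simps)
    then show "edge_weight N b t \<sigma> \<tau> = edge_weight N b 0 \<sigma> \<tau> * (1 / (1 + t * (1 / diag_rate N b \<sigma>)))"
      by (simp add: edge_weight_def)
  qed
  then show ?thesis
    unfolding weight_conv damping_def map_map by (simp only: walk_weight_scale comp_def)
qed

text \<open>At each vertex the two weights differ by the factor \<open>out_rate / diag_rate\<close>,
  which is \<open>1 + rel_growth\<close> and at most 2.\<close>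

lemma weight_0_conv_markov_weight:
  assumes "1 < b"
  shows "weight N b 0 \<gamma> = (1 + path_growth N b \<gamma>) * markov_weight N b \<gamma>"
    and "successively (edge N) \<gamma> \<Longrightarrow> weight N b 0 \<gamma> \<le> 2 ^ (length \<gamma> - 1) * markov_weight N b \<gamma>"
proof -
  have e: "edge_weight N b 0 \<sigma> \<tau> = trans_rate N b \<sigma> \<tau> / out_rate N b \<sigma> * (out_rate N b \<sigma> / diag_rate N b \<sigma>)"
    for \<sigma> \<tau> using rates(2)[OF assms, of \<sigma>] by (simp add: edge_weight_def)
  show eq: "weight N b 0 \<gamma> = (1 + path_growth N b \<gamma>) * markov_weight N b \<gamma>"
    unfolding weight_def markov_weight_def path_growth_def
    by (simp add: prod.distrib[symmetric] rates(6)[OF assms] e mult.commute)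
  assume g: "successively (edge N) \<gamma>"
  have "1 + path_growth N b \<gamma> \<le> (\<Prod>i<length \<gamma> - 1. 2)"
    unfolding path_growth_def using rates[OF assms]
    by (simp add: rates(6)[OF assms] del: prod_constant)
       (intro prod_mono, auto simp: pos_divide_le_eq less_imp_le)
  moreover have "0 \<le> markov_weight N b \<gamma>"
    unfolding markov_weight_conv
    by (rule walk_weight_mono(1)[OF g order.refl[THEN order.trans]])
       (use trans_rate_nonneg[OF wf assms] rates(2)[OF assms] in \<open>auto simp: edge_def less_imp_le\<close>)
  ultimately show "weight N b 0 \<gamma> \<le> 2 ^ (length \<gamma> - 1) * markov_weight N b \<gamma>"
    unfolding eq by (intro mult_right_mono) auto
qed

text \<open>Moving the diagonal term of the eigenvalue equation to the other side turns its row
  \<sigma> into a balance of the flows into \<sigma>.\<close>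

lemma lyapunov_weight_invariant:
  assumes b: "1 < b" and lam: "0 < lyapunov_exponent N b" and v: "lyapunov_eigenvector N b v"
  shows "0 < lyapunov_weight N b v \<sigma>"
    and "lyapunov_weight N b v \<sigma> = (\<Sum>\<tau> | edge N \<tau> \<sigma>.
      lyapunov_weight N b v \<tau> * edge_weight N b (lyapunov_exponent N b) \<tau> \<sigma>)"
proof -
  let ?l = "lyapunov_exponent N b"
  have dl: "0 < diag_rate N b \<tau> + ?l" for \<tau> using rates(1)[OF b, of \<tau>] lam by linarith
  have pi: "lyapunov_weight N b v \<tau> = (diag_rate N b \<tau> + ?l) * v $ \<tau>" for \<tau>
    by (simp add: lyapunov_weight_def diag_rate_def)
  show "0 < lyapunov_weight N b v \<sigma>"
    unfolding pi using dl v by (auto simp: lyapunov_eigenvector_def)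
  have "(generator N b *v v) $ \<sigma> = (?l *s v) $ \<sigma>"
    using v by (simp add: lyapunov_eigenvector_def)
  then have "(\<Sum>\<tau>\<in>UNIV. generator N b $ \<sigma> $ \<tau> * v $ \<tau>) = ?l * v $ \<sigma>"
    by (simp add: matrix_vector_mult_def)
  moreover have "(\<Sum>\<tau>\<in>UNIV. generator N b $ \<sigma> $ \<tau> * v $ \<tau>) =
      generator N b $ \<sigma> $ \<sigma> * v $ \<sigma> + (\<Sum>\<tau>\<in>UNIV - {\<sigma>}. trans_rate N b \<tau> \<sigma> * v $ \<tau>)"
    unfolding trans_rate_def by (rule sum.remove) auto
  ultimately have "lyapunov_weight N b v \<sigma> = (\<Sum>\<tau>\<in>UNIV - {\<sigma>}. trans_rate N b \<tau> \<sigma> * v $ \<tau>)"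
    unfolding pi rates(5)[OF b] by (simp add: algebra_simps)
  also have "\<dots> = (\<Sum>\<tau> | edge N \<tau> \<sigma>. trans_rate N b \<tau> \<sigma> * v $ \<tau>)"
    by (rule sum.mono_neutral_right) (use trans_rate_eq_0[OF wf b] in \<open>auto simp: edge_def\<close>)
  also have "\<dots> = (\<Sum>\<tau> | edge N \<tau> \<sigma>. lyapunov_weight N b v \<tau> * edge_weight N b ?l \<tau> \<sigma>)"
    unfolding pi edge_weight_def using dl by (intro sum.cong) (auto simp: less_imp_neq[symmetric])
  finally show "lyapunov_weight N b v \<sigma> = \<dots>" .
qed

end

section \<open>High and low excursions\<close>

lemma infsum_add_cmult:
  fixes f g :: "'a \<Rightarrow> real"
  assumes "f summable_on A" "g summable_on A"
  shows "(\<lambda>x. f x + c * g x) summable_on A"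
    and "(\<Sum>\<^sub>\<infinity>x\<in>A. f x + c * g x) = infsum f A + c * infsum g A"
proof -
  have "((\<lambda>x. f x + c * g x) has_sum infsum f A + c * infsum g A) A"
    using assms by (intro has_sum_add has_sum_cmult_right) simp_all
  then show "(\<lambda>x. f x + c * g x) summable_on A"
    "(\<Sum>\<^sub>\<infinity>x\<in>A. f x + c * g x) = infsum f A + c * infsum g A"
    by (auto simp: infsumI summable_on_def)
qed

text \<open>The factor 4 comes from \<open>cost_summable\<close>, \<open>2 * short\<close> bounds
  the number of edges of the short excursions and so their cost, and the power of 2 bounds the ratio
  of the two weights along them.\<close>

definition low_const :: "'v::finite itself \<Rightarrow> real" where
  "low_const _ = 4 * (2 * real (short TYPE('v)) * 2 ^ (2 * short TYPE('v)))"

text \<open>A single base is fixed, large enough that short loops are small. The constants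
  \<open>low_const\<close> and \<open>upper_const\<close> depend on the number of vertices alone,
  which makes the estimates uniform in \<open>b\<close>.\<close>

locale large_base = irreducible_network N for N :: "('r, 'v::finite) network" +
  fixes s :: 'v and b :: real and hi :: int
  assumes b: "1 < b" and loops: "small_loops (edge N) (majorant b) s"
begin

abbreviation "low \<equiv> low_excursions N s hi"
abbreviation "high \<equiv> high_excursions N s hi"
abbreviation "returns \<equiv> excursions (edge N) s s"
abbreviation "inv_rate \<sigma> \<equiv> 1 / diag_rate N b \<sigma>"

lemma high_conv: "high = returns \<inter> lists {\<sigma>. hi \<le> vertex_scale N \<sigma>}"
  using excursion_conv[of N s s] by (auto simp: high_excursions_def)

lemma low_conv: "low = returns - high"
  by (simp add: low_excursions_def excursion_conv)

lemma walks: "\<gamma> \<in> returns \<Longrightarrow> successively (edge N) \<gamma>"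
  by (simp add: excursions_def)

lemma weight_loops:
  assumes "\<And>\<sigma>. - diag_rate N b \<sigma> / 2 \<le> \<alpha>"
  shows "small_loops (edge N) (edge_weight N b \<alpha>) s"
  by (rule small_loops_antimono[OF loops edge_weight_le_majorant[OF b assms]])

lemma weight_loops_nonneg: "0 \<le> \<alpha> \<Longrightarrow> small_loops (edge N) (edge_weight N b \<alpha>) s"
proof (rule weight_loops)
  show "- diag_rate N b \<sigma> / 2 \<le> \<alpha>" if "0 \<le> \<alpha>" for \<sigma>
    using rates(1)[OF b, of \<sigma>] that by linarith
qed

lemma markov_loops: "small_loops (edge N) (\<lambda>\<sigma> \<tau>. trans_rate N b \<sigma> \<tau> / out_rate N b \<sigma>) s"
proof (rule small_loops_antimono[OF loops])
  fix x y assume "edge N x y"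
  from majorant_bounds(1)[OF b this]
  show "0 \<le> trans_rate N b x y / out_rate N b x \<and> trans_rate N b x y / out_rate N b x \<le> majorant b x y"
    unfolding majorant_def by linarith
qed

lemma weight_nonneg: "0 \<le> \<alpha> \<Longrightarrow> successively (edge N) \<gamma> \<Longrightarrow> 0 \<le> weight N b \<alpha> \<gamma>"
  unfolding weight_conv by (rule small_loops.walk_nonneg[OF weight_loops_nonneg])

lemma weight_antimono:
  assumes "0 \<le> \<alpha>" "\<alpha> \<le> \<beta>" "successively (edge N) \<gamma>"
  shows "weight N b \<beta> \<gamma> \<le> weight N b \<alpha> \<gamma>"
proof -
  have "edge_weight N b \<beta> \<sigma> \<tau> \<le> edge_weight N b \<alpha> \<sigma> \<tau>" if "edge N \<sigma> \<tau>" for \<sigma> \<tau>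
    unfolding edge_weight_def
    using that assms(1,2) rates(1)[OF b, of \<sigma>] trans_rate_nonneg[OF wf b, of \<sigma> \<tau>]
    by (intro divide_left_mono mult_pos_pos) (auto simp: edge_def)
  moreover have "0 \<le> \<beta>" using assms by simp
  ultimately show ?thesis
    unfolding weight_conv
    by (intro walk_weight_mono(2)[OF assms(3)] small_loops.nonneg[OF weight_loops_nonneg])
qed

lemma weight_summable:
  assumes "0 \<le> \<alpha>" "A \<subseteq> excursions (edge N) s t"
  shows "weight N b \<alpha> summable_on A"
proof (rule summable_on_subset_banach[OF _ assms(2)])
  show "weight N b \<alpha> summable_on excursions (edge N) s t"
    using small_loops.weight_summable[OF weight_loops_nonneg[OF assms(1)], of t UNIV]
    by (simp add: weight_conv)
qed

lemma markov_weight_nonneg: "successively (edge N) \<gamma> \<Longrightarrow> 0 \<le> markov_weight N b \<gamma>"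
  unfolding markov_weight_conv by (rule small_loops.walk_nonneg[OF markov_loops])

lemma markov_weight_has_sum: "(markov_weight N b has_sum 1) returns"
  unfolding markov_weight_conv
proof (rule stochastic_excursions[OF markov_loops])
  fix \<sigma>
  have "out_rate N b \<sigma> = (\<Sum>\<tau> | edge N \<sigma> \<tau>. trans_rate N b \<sigma> \<tau>)"
    unfolding out_rate_def
  proof (rule sum.mono_neutral_right)
    show "{\<tau>. edge N \<sigma> \<tau>} \<subseteq> UNIV - {\<sigma>}" by (auto simp: edge_def)
  qed (use trans_rate_eq_0[OF wf b not_sym] in auto)
  then show "(\<Sum>\<tau> | edge N \<sigma> \<tau>. trans_rate N b \<sigma> \<tau> / out_rate N b \<sigma>) = 1"
    using rates(2)[OF b, of \<sigma>] by (simp add: sum_divide_distrib[symmetric])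
qed

lemma markov_weight_summable: "A \<subseteq> returns \<Longrightarrow> markov_weight N b summable_on A"
  by (rule summable_on_subset_banach[OF has_sum_imp_summable[OF markov_weight_has_sum]])

lemma split_all:
  fixes f :: "'v list \<Rightarrow> real"
  assumes "f summable_on returns"
  shows "infsum f returns = infsum f high + infsum f low"
proof -
  have "returns = high \<union> low" "high \<inter> low = {}" by (auto simp: low_conv high_conv)
  moreover have "f summable_on high" "f summable_on low"
    by (rule summable_on_subset_banach[OF assms]; simp add: high_conv low_conv)+
  ultimately show ?thesis using infsum_Un_disjoint[of f high low] by simp
qed

text \<open>The Markov weights of all returns add up to 1, so those of the high ones add up to
  \<open>1 - S_low\<close>; the rest of the high sum at shift 0 is \<open>S_high\<close>.\<close>

lemma delta_c_high_conv:
  "delta_c_high N s hi b = infsum (weight N b 0) high - 1"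
  "delta_c_high N s hi b = S_high N s hi b - S_low N s hi b"
proof -
  show eq: "delta_c_high N s hi b = infsum (weight N b 0) high - 1"
    by (simp add: delta_c_high_def weight_0_conv_markov_weight(1)[OF b, abs_def])
  have hs: "high \<subseteq> returns" by (auto simp: high_conv)
  have "S_high N s hi b = (\<Sum>\<^sub>\<infinity>\<gamma>\<in>high. weight N b 0 \<gamma> + (- 1) * markov_weight N b \<gamma>)"
    unfolding S_high_def by (simp add: weight_0_conv_markov_weight(1)[OF b] algebra_simps)
  also have "\<dots> = infsum (weight N b 0) high - infsum (markov_weight N b) high"
    using infsum_add_cmult(2)[OF weight_summable[OF order.refl hs] markov_weight_summable[OF hs], of "- 1"] by simp
  finally have "S_high N s hi b = infsum (weight N b 0) high - infsum (markov_weight N b) high" .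
  moreover have "1 = infsum (markov_weight N b) high + S_low N s hi b"
    using split_all[OF markov_weight_summable[OF order.refl]] infsumI[OF markov_weight_has_sum]
    by (simp add: S_low_def)
  ultimately show "delta_c_high N s hi b = S_high N s hi b - S_low N s hi b" using eq by simp
qed

definition slope :: real where
  "slope = (\<Sum>\<^sub>\<infinity>\<gamma>\<in>high. weight N b 0 \<gamma> * walk_cost inv_rate \<gamma>)"

lemma cost_terms_nonneg: "\<gamma> \<in> returns \<Longrightarrow> 0 \<le> weight N b 0 \<gamma> * walk_cost inv_rate \<gamma>"
  using rates(1)[OF b] by (intro mult_nonneg_nonneg weight_nonneg walk_cost_nonneg walks) (auto simp: less_imp_le)

lemma slope_nonneg: "0 \<le> slope"
  unfolding slope_def by (rule infsum_nonneg) (use cost_terms_nonneg in \<open>auto simp: high_conv\<close>)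

lemma cost_terms_summable: "(\<lambda>\<gamma>. weight N b 0 \<gamma> * walk_cost inv_rate \<gamma>) summable_on high"
  and slope_le_short: "slope \<le> 4 * (\<Sum>\<gamma> | \<gamma> \<in> high \<and> length \<gamma> \<le> 2 * short TYPE('v).
    weight N b 0 \<gamma> * walk_cost inv_rate \<gamma>)"
  unfolding slope_def high_conv weight_conv
  by (rule small_loops.cost_summable[OF weight_loops_nonneg]; use rates(1)[OF b] in \<open>simp add: less_imp_le\<close>)+

lemma c'_high_conv: "c'_high N s hi b = slope"
proof -
  \<comment> \<open>Half the smallest rate: shifts down to \<open>- h\<close> keep every edge weight
    below the majorant, so the high sum still converges to the left of 0.\<close>
  define h where "h = Min (range (diag_rate N b)) / 2"
  have "0 < Min (range (diag_rate N b))" using rates(1)[OF b] by (subst Min_gr_iff) auto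
  moreover have "Min (range (diag_rate N b)) \<le> diag_rate N b \<sigma>" for \<sigma> by (rule Min_le) auto
  ultimately have h: "0 < h" "h \<le> diag_rate N b \<sigma> / 2" for \<sigma> by (auto simp: h_def)
  let ?rs = "\<lambda>\<gamma>. map inv_rate (butlast \<gamma>)"
  have "- diag_rate N b \<sigma> / 2 \<le> - h" for \<sigma> using h(2)[of \<sigma>] by simp
  from small_loops.weight_summable[OF weight_loops[OF this]]
  have "weight N b (- h) summable_on high" unfolding high_conv weight_conv by blast
  then have sm: "(\<lambda>\<gamma>. weight N b 0 \<gamma> * damping (- h) (?rs \<gamma>)) summable_on high"
    by (simp add: weight_damping[OF b, of "- h", symmetric])
  have "0 \<le> inv_rate \<sigma> \<and> h * inv_rate \<sigma> < 1" for \<sigma>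
  proof -
    have "h < diag_rate N b \<sigma>" using h(2)[of \<sigma>] rates(1)[OF b, of \<sigma>] by linarith
    then show ?thesis using rates(1)[OF b, of \<sigma>] by (simp add: field_simps)
  qed
  then have "((\<lambda>t. \<Sum>\<^sub>\<infinity>\<gamma>\<in>high. weight N b 0 \<gamma> * damping t (?rs \<gamma>)) has_real_derivative
      - (\<Sum>\<^sub>\<infinity>\<gamma>\<in>high. weight N b 0 \<gamma> * sum_list (?rs \<gamma>))) (at 0)"
    by (intro damped_sum_derivative(2)[OF h(1) _ _ sm] weight_nonneg) (auto simp: high_conv intro: walks)
  then have "((\<lambda>t. infsum (weight N b t) high) has_real_derivative - slope) (at 0)"
    by (simp add: weight_damping[OF b, symmetric] slope_def walk_cost_def)
  then show ?thesis unfolding c'_high_def by (simp add: DERIV_imp_deriv)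
qed

lemma high_ge_tangent:
  assumes "0 \<le> \<alpha>"
  shows "infsum (weight N b 0) high - \<alpha> * slope \<le> infsum (weight N b \<alpha>) high"
proof -
  have hs: "high \<subseteq> returns" by (auto simp: high_conv)
  note s = infsum_add_cmult[OF weight_summable[OF order.refl hs] cost_terms_summable, of "- \<alpha>"]
  have "infsum (weight N b 0) high + (- \<alpha>) * slope =
      (\<Sum>\<^sub>\<infinity>\<gamma>\<in>high. weight N b 0 \<gamma> + (- \<alpha>) * (weight N b 0 \<gamma> * walk_cost inv_rate \<gamma>))"
    unfolding slope_def by (rule s(2)[symmetric])
  also have "\<dots> \<le> infsum (weight N b \<alpha>) high"
  proof (rule infsum_mono[OF s(1) weight_summable[OF assms hs]])
    fix \<gamma> assume g: "\<gamma> \<in> high"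
    have "1 - \<alpha> * walk_cost inv_rate \<gamma> \<le> damping \<alpha> (map inv_rate (butlast \<gamma>))"
      unfolding walk_cost_def using rates(1)[OF b] assms
      by (intro damping_ge_linear) (auto simp: less_imp_le intro!: add_pos_nonneg)
    from mult_left_mono[OF this, of "weight N b 0 \<gamma>"]
    show "weight N b 0 \<gamma> + (- \<alpha>) * (weight N b 0 \<gamma> * walk_cost inv_rate \<gamma>) \<le> weight N b \<alpha> \<gamma>"
      using weight_nonneg[of 0 \<gamma>] walks g hs
      by (auto simp: weight_damping[OF b, of \<alpha>] algebra_simps)
  qed
  finally show ?thesis by simp
qed

text \<open>By \<open>slope_le_short\<close>, excursions of length at most \<open>2 * short\<close>
  carry at least a quarter of the slope. On each of them \<alpha> times the cost is bounded, so the
  hyperbolic bound yields a decrease that is linear in \<alpha> up to a constant.\<close>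

lemma high_decrease:
  assumes \<alpha>: "0 \<le> \<alpha>" "\<alpha> \<le> b powi hi"
  shows "infsum (weight N b \<alpha>) high \<le>
    infsum (weight N b 0) high - \<alpha> * slope / (4 * (1 + 4 * real (short TYPE('v))))"
proof -
  let ?L = "short TYPE('v)"
  let ?S = "{\<gamma>. \<gamma> \<in> high \<and> length \<gamma> \<le> 2 * ?L}" and ?X = "walk_cost inv_rate"
  define K where "K = 1 + 4 * real ?L"
  have K: "0 < K" by (simp add: K_def)
  have hs: "high \<subseteq> returns" by (auto simp: high_conv)
  have drop: "\<alpha> / K * (weight N b 0 \<gamma> * ?X \<gamma>) \<le> weight N b 0 \<gamma> + (- 1) * weight N b \<alpha> \<gamma>" if g: "\<gamma> \<in> ?S" for \<gamma>
  proof -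
    let ?d = "damping \<alpha> (map inv_rate (butlast \<gamma>))"
    have X0: "0 \<le> \<alpha> * ?X \<gamma>"
      using \<alpha>(1) rates(1)[OF b] by (intro mult_nonneg_nonneg walk_cost_nonneg) (auto simp: less_imp_le)
    have "\<alpha> * ?X \<gamma> = (\<Sum>i<length \<gamma> - 1. \<alpha> * inv_rate (\<gamma> ! i))"
      by (simp add: walk_cost_conv_sum sum_distrib_left)
    also have "\<dots> \<le> (\<Sum>i<length \<gamma> - 1. 2)"
    \<comment> \<open>At a high vertex \<open>b powi hi\<close> is at most \<open>out_rate\<close>,
      hence at most twice \<open>diag_rate\<close>, so each edge contributes at most 2.\<close>
    proof (rule sum_mono)
      fix i assume "i \<in> {..<length \<gamma> - 1}"
      then have "\<gamma> ! i \<in> set \<gamma>" by simp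
      then have "hi \<le> vertex_scale N (\<gamma> ! i)" using g by (auto simp: high_conv)
      then have "b powi hi \<le> b powi vertex_scale N (\<gamma> ! i)"
        using b by (intro power_int_increasing) auto
      then have "\<alpha> \<le> 2 * diag_rate N b (\<gamma> ! i)"
        using \<alpha>(2) out_rate_ge_scale[OF b, of "\<gamma> ! i"] rates(4)[OF b, of "\<gamma> ! i"] by linarith
      then show "\<alpha> * inv_rate (\<gamma> ! i) \<le> 2"
        using rates(1)[OF b, of "\<gamma> ! i"] by (simp add: pos_divide_le_eq)
    qed
    also have "\<dots> \<le> 4 * real ?L"
    proof -
      have "length \<gamma> - 1 \<le> 2 * ?L" using g by auto
      then have "real (length \<gamma> - 1) \<le> real (2 * ?L)" by (rule of_nat_mono)
      then show ?thesis by simp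
    qed
    finally have XK: "1 + \<alpha> * ?X \<gamma> \<le> K" by (simp add: K_def)
    have "?d * (1 + \<alpha> * ?X \<gamma>) \<le> 1"
      unfolding walk_cost_def using rates(1)[OF b] \<alpha>(1)
      by (intro damping_le_hyperbolic) (auto simp: less_imp_le)
    then have "?d \<le> 1 / (1 + \<alpha> * ?X \<gamma>)" using X0 by (simp add: pos_le_divide_eq)
    then have "\<alpha> * ?X \<gamma> / (1 + \<alpha> * ?X \<gamma>) \<le> 1 - ?d"
      using X0 by (simp add: field_simps)
    moreover have "\<alpha> * ?X \<gamma> / K \<le> \<alpha> * ?X \<gamma> / (1 + \<alpha> * ?X \<gamma>)"
      using X0 XK by (intro divide_left_mono) auto
    ultimately have "\<alpha> * ?X \<gamma> / K \<le> 1 - ?d" by linarith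
    from mult_left_mono[OF this, of "weight N b 0 \<gamma>"] show ?thesis
      using weight_nonneg[of 0 \<gamma>] walks g hs
      by (auto simp: weight_damping[OF b, of \<alpha>] algebra_simps)
  qed
  note s = infsum_add_cmult[OF weight_summable[OF order.refl hs] weight_summable[OF \<alpha>(1) hs], of "- 1"]
  have "\<alpha> / K * slope \<le> \<alpha> / K * (4 * (\<Sum>\<gamma>\<in>?S. weight N b 0 \<gamma> * ?X \<gamma>))"
    using slope_le_short \<alpha>(1) K by (intro mult_left_mono) auto
  also have "\<dots> = 4 * (\<Sum>\<gamma>\<in>?S. \<alpha> / K * (weight N b 0 \<gamma> * ?X \<gamma>))"
    by (simp add: sum_distrib_left mult_ac)
  also have "\<dots> \<le> 4 * (\<Sum>\<gamma>\<in>?S. weight N b 0 \<gamma> + (- 1) * weight N b \<alpha> \<gamma>)"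
    using drop by (intro mult_left_mono sum_mono) auto
  also have "\<dots> \<le> 4 * (\<Sum>\<^sub>\<infinity>\<gamma>\<in>high. weight N b 0 \<gamma> + (- 1) * weight N b \<alpha> \<gamma>)"
  proof (intro mult_left_mono finite_sum_le_infsum[OF s(1)])
    fix \<gamma> assume "\<gamma> \<in> high - ?S"
    then show "0 \<le> weight N b 0 \<gamma> + (- 1) * weight N b \<alpha> \<gamma>"
      using weight_antimono[OF order.refl \<alpha>(1), of \<gamma>] walks hs by auto
  qed auto
  also have "(\<Sum>\<^sub>\<infinity>\<gamma>\<in>high. weight N b 0 \<gamma> + (- 1) * weight N b \<alpha> \<gamma>) =
      infsum (weight N b 0) high - infsum (weight N b \<alpha>) high"
    using s(2) by simp
  finally show ?thesis using K by (simp add: K_def field_simps)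
qed

text \<open>Erasing a loop may remove the only low vertex, so low excursions cannot simply be
  reduced to short low ones. They are detected by the cost counting low vertices, which is at least
  1 on low excursions and 0 on high ones; \<open>cost_summable\<close> then leaves short low
  excursions, where the two weights are comparable.\<close>

lemma low_weight_le:
  assumes "0 \<le> \<alpha>"
  shows "infsum (weight N b \<alpha>) low \<le> low_const TYPE('v) * S_low N s hi b"
proof -
  let ?L = "short TYPE('v)"
  let ?c = "\<lambda>\<sigma>. if hi \<le> vertex_scale N \<sigma> then 0 else 1 :: real"
  let ?S = "{\<gamma>. \<gamma> \<in> returns \<and> length \<gamma> \<le> 2 * ?L}"
  have ls: "low \<subseteq> returns" by (auto simp: low_conv)
  have all_lists: "returns \<inter> lists UNIV = returns" by auto
  note cs = small_loops.cost_summable[OF weight_loops_nonneg[of 0], where U = UNIV and c = ?c,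
      folded weight_conv, unfolded all_lists]
  have nn: "0 \<le> weight N b 0 \<gamma> * walk_cost ?c \<gamma>" if "\<gamma> \<in> returns" for \<gamma>
    using that by (intro mult_nonneg_nonneg weight_nonneg walks walk_cost_nonneg) auto
  have low1: "1 \<le> walk_cost ?c \<gamma>" if "\<gamma> \<in> low" for \<gamma>
  proof -
    have g: "\<gamma> \<in> returns" "\<not> (\<forall>\<sigma>\<in>set \<gamma>. hi \<le> vertex_scale N \<sigma>)"
      using that by (auto simp: low_conv high_conv)
    \<comment> \<open>The cost ignores the last vertex, but on a return this vertex is also the
      first one.\<close>
    obtain zs z where z: "\<gamma> = zs @ [z]" using g(1) by (cases \<gamma> rule: rev_cases) (auto simp: excursions_def)
    then have "zs \<noteq> []" "hd zs = z" using g(1) by (auto simp: excursions_def hd_append split: if_splits)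
    then have "set \<gamma> \<subseteq> set (butlast \<gamma>)" using z hd_in_set by fastforce
    with g(2) obtain \<sigma> where s: "\<sigma> \<in> set (butlast \<gamma>)" "\<not> hi \<le> vertex_scale N \<sigma>" by blast
    then have "?c \<sigma> \<le> walk_cost ?c \<gamma>"
      unfolding walk_cost_def by (intro member_le_sum_list) auto
    with s show ?thesis by simp
  qed
  have "infsum (weight N b \<alpha>) low \<le> infsum (weight N b 0) low"
    using weight_antimono[OF order.refl assms] walks ls
    by (intro infsum_mono weight_summable[OF _ ls] assms) auto
  also have "\<dots> \<le> (\<Sum>\<^sub>\<infinity>\<gamma>\<in>returns. weight N b 0 \<gamma> * walk_cost ?c \<gamma>)"
  proof (rule infsum_mono_neutral[OF weight_summable[OF order.refl ls] cs(1)])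
    fix \<gamma> assume "\<gamma> \<in> low \<inter> returns"
    then show "weight N b 0 \<gamma> \<le> weight N b 0 \<gamma> * walk_cost ?c \<gamma>"
      using low1 weight_nonneg[of 0 \<gamma>] walks by (auto intro!: mult_left_le_one_le[THEN order.trans] simp: mult_le_cancel_left1)
  qed (use nn ls in auto)
  also have "\<dots> \<le> 4 * (\<Sum>\<gamma>\<in>?S. weight N b 0 \<gamma> * walk_cost ?c \<gamma>)"
    by (rule cs(2)) auto
  also have "(\<Sum>\<gamma>\<in>?S. weight N b 0 \<gamma> * walk_cost ?c \<gamma>) =
      (\<Sum>\<gamma> | \<gamma> \<in> low \<and> length \<gamma> \<le> 2 * ?L. weight N b 0 \<gamma> * walk_cost ?c \<gamma>)"
  proof (rule sum.mono_neutral_right)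
    show "\<forall>\<gamma>\<in>?S - {\<gamma>. \<gamma> \<in> low \<and> length \<gamma> \<le> 2 * ?L}. weight N b 0 \<gamma> * walk_cost ?c \<gamma> = 0"
    proof
      fix \<gamma> assume "\<gamma> \<in> ?S - {\<gamma>. \<gamma> \<in> low \<and> length \<gamma> \<le> 2 * ?L}"
      then have "\<forall>\<sigma>\<in>set \<gamma>. hi \<le> vertex_scale N \<sigma>" by (auto simp: low_conv high_conv)
      then have "map ?c (butlast \<gamma>) = map (\<lambda>_. 0) (butlast \<gamma>)"
        by (intro map_cong) (auto dest: in_set_butlastD)
      then have "walk_cost ?c \<gamma> = 0" unfolding walk_cost_def by (simp only:) simp
      then show "weight N b 0 \<gamma> * walk_cost ?c \<gamma> = 0" by simp
    qed
  qed (use ls in auto)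
  also have "\<dots> \<le> (\<Sum>\<gamma> | \<gamma> \<in> low \<and> length \<gamma> \<le> 2 * ?L. 2 * real ?L * 2 ^ (2 * ?L) * markov_weight N b \<gamma>)"
  proof (rule sum_mono)
    fix \<gamma> assume g: "\<gamma> \<in> {\<gamma>. \<gamma> \<in> low \<and> length \<gamma> \<le> 2 * ?L}"
    then have w: "successively (edge N) \<gamma>" using ls walks by auto
    have "walk_cost ?c \<gamma> \<le> (\<Sum>i<length \<gamma> - 1. 1)"
      unfolding walk_cost_conv_sum by (rule sum_mono) auto
    also have "\<dots> \<le> 2 * real ?L"
    proof -
      have "length \<gamma> - 1 \<le> 2 * ?L" using g by auto
      then have "real (length \<gamma> - 1) \<le> real (2 * ?L)" by (rule of_nat_mono)
      then show ?thesis by simp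
    qed
    finally have c: "walk_cost ?c \<gamma> \<le> 2 * real ?L" .
    have "weight N b 0 \<gamma> \<le> 2 ^ (length \<gamma> - 1) * markov_weight N b \<gamma>"
      by (rule weight_0_conv_markov_weight(2)[OF b w])
    also have "\<dots> \<le> 2 ^ (2 * ?L) * markov_weight N b \<gamma>"
      using g by (intro mult_right_mono markov_weight_nonneg w power_increasing) auto
    finally have "weight N b 0 \<gamma> * walk_cost ?c \<gamma> \<le> 2 ^ (2 * ?L) * markov_weight N b \<gamma> * (2 * real ?L)"
      using c markov_weight_nonneg[OF w] by (intro mult_mono walk_cost_nonneg) auto
    then show "weight N b 0 \<gamma> * walk_cost ?c \<gamma> \<le> 2 * real ?L * 2 ^ (2 * ?L) * markov_weight N b \<gamma>"
      by (simp add: mult_ac)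
  qed
  also have "\<dots> = 2 * real ?L * 2 ^ (2 * ?L) * (\<Sum>\<gamma> | \<gamma> \<in> low \<and> length \<gamma> \<le> 2 * ?L. markov_weight N b \<gamma>)"
    by (simp add: sum_distrib_left)
  also have "\<dots> \<le> 2 * real ?L * 2 ^ (2 * ?L) * S_low N s hi b"
    unfolding S_low_def using ls walks
    by (intro mult_left_mono finite_sum_le_infsum markov_weight_summable markov_weight_nonneg) auto
  finally show ?thesis by (simp add: low_const_def)
qed

lemma S_low_nonneg: "0 \<le> S_low N s hi b"
  unfolding S_low_def by (rule infsum_nonneg) (auto simp: low_conv intro: markov_weight_nonneg walks)

end

section \<open>The asymptotic comparison\<close>

lemma asymp_simI:
  assumes "1 \<le> C" "\<forall>\<^sub>F b in at_top. x b \<le> C * y b \<and> y b \<le> C * x b"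
  shows "x \<simeq> y"
  unfolding asymp_sim_def using assms
  by (intro exI[of _ C] conjI) (auto elim!: eventually_mono simp: field_simps)

lemma asymp_simE:
  assumes "x \<simeq> y"
  obtains C where "1 \<le> C" "\<forall>\<^sub>F b in at_top. x b \<le> C * y b \<and> y b \<le> C * x b"
proof -
  obtain C where C: "1 \<le> C" "\<forall>\<^sub>F b in at_top. inverse C * y b \<le> x b \<and> x b \<le> C * y b"
    using assms unfolding asymp_sim_def by blast
  have "\<forall>\<^sub>F b in at_top. x b \<le> C * y b \<and> y b \<le> C * x b"
    using C(2) by eventually_elim (use C(1) in \<open>auto simp: field_simps\<close>)
  with C(1) show thesis by (rule that)
qed

lemma asymp_sim_sym: "x \<simeq> y \<Longrightarrow> y \<simeq> x"
  by (elim asymp_simE, rule asymp_simI) (auto elim: eventually_mono)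

lemma asymp_sim_trans [trans]:
  assumes "x \<simeq> y" "y \<simeq> z"
  shows "x \<simeq> z"
proof -
  obtain C where C: "1 \<le> C" "\<forall>\<^sub>F b in at_top. x b \<le> C * y b \<and> y b \<le> C * x b"
    using assms(1) by (rule asymp_simE)
  obtain D where D: "1 \<le> D" "\<forall>\<^sub>F b in at_top. y b \<le> D * z b \<and> z b \<le> D * y b"
    using assms(2) by (rule asymp_simE)
  show ?thesis
  proof (rule asymp_simI)
    show "1 \<le> C * D" using mult_mono[OF C(1) D(1)] C(1) by simp
    show "\<forall>\<^sub>F b in at_top. x b \<le> C * D * z b \<and> z b \<le> C * D * x b"
      using C(2) D(2)
    proof eventually_elim
      case (elim b)
      have "C * y b \<le> C * (D * z b)" "D * y b \<le> D * (C * x b)"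
        using elim C(1) D(1) by (auto intro: mult_left_mono)
      with elim show ?case by (simp add: mult_ac)
    qed
  qed
qed

lemma asymp_sim_mult_1:
  assumes "x \<simeq> (\<lambda>b. 1)" "y \<simeq> z" "\<forall>\<^sub>F b in at_top. 0 \<le> y b"
  shows "(\<lambda>b. x b * y b) \<simeq> z"
proof -
  obtain C where C: "1 \<le> C" "\<forall>\<^sub>F b in at_top. x b \<le> C * 1 \<and> 1 \<le> C * x b"
    using assms(1) by (rule asymp_simE)
  have "(\<lambda>b. x b * y b) \<simeq> y"
  proof (rule asymp_simI[OF C(1)])
    show "\<forall>\<^sub>F b in at_top. x b * y b \<le> C * y b \<and> y b \<le> C * (x b * y b)"
      using C(2) assms(3)
    proof eventually_elim
      case (elim b)
      have "x b * y b \<le> C * y b" "1 * y b \<le> C * x b * y b"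
        using elim by (intro mult_right_mono; simp)+
      then show ?case by (simp add: mult_ac)
    qed
  qed
  then show ?thesis using assms(2) by (rule asymp_sim_trans)
qed

text \<open>Three times the denominator in \<open>high_decrease\<close>. At this multiple of the
  threshold the high sum has dropped by three times \<open>delta_c_high\<close>: once to reach 1,
  once to make up for the low sum, and once for strictness.\<close>

definition upper_const :: "'v::finite itself \<Rightarrow> real" where
  "upper_const _ = 3 * (4 * (1 + 4 * real (short TYPE('v))))"

section \<open>Lyapunov weights as excursion sums, and the threshold against the exponent\<close>

context large_base
begin

lemma lyapunov_excursion_sum:
  assumes "0 < lyapunov_exponent N b" "lyapunov_eigenvector N b v"
  shows "lyapunov_weight N b v t =
    lyapunov_weight N b v s * excursion_sum N b (lyapunov_exponent N b) s t"
proof -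
  let ?l = "lyapunov_exponent N b"
  note pi = lyapunov_weight_invariant[OF b assms]
  have "((\<lambda>\<gamma>. lyapunov_weight N b v s * weight N b ?l \<gamma>) has_sum lyapunov_weight N b v t)
      (excursions (edge N) s t)"
    unfolding weight_conv
    by (rule small_loops.invariant_has_sum[OF weight_loops_nonneg pi(2)])
       (use assms(1) pi(1)[of s] in auto)
  moreover have "((\<lambda>\<gamma>. lyapunov_weight N b v s * weight N b ?l \<gamma>) has_sum
      lyapunov_weight N b v s * infsum (weight N b ?l) (excursions (edge N) s t)) (excursions (edge N) s t)"
    by (intro has_sum_cmult_right has_sum_infsum weight_summable[OF _ order.refl])
       (use assms(1) in simp)
  ultimately show ?thesis unfolding excursion_sum_def excursion_conv by (rule has_sum_unique)
qed

lemma excursion_sum_nonneg: "0 \<le> \<alpha> \<Longrightarrow> 0 \<le> excursion_sum N b \<alpha> s t"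
  unfolding excursion_sum_def excursion_conv
  by (rule infsum_nonneg) (auto simp: excursions_def intro: weight_nonneg)

lemma threshold_bounds:
  assumes thr: "0 < alpha_thr N s hi b" and lam: "0 < \<mu>"
    and return: "infsum (weight N b \<mu>) returns = 1"
  shows "0 < delta_c_high N s hi b" "alpha_thr N s hi b \<le> \<mu>"
    and "\<lbrakk>upper_const TYPE('v) * alpha_thr N s hi b \<le> b powi hi;
      low_const TYPE('v) * S_low N s hi b \<le> delta_c_high N s hi b\<rbrakk>
      \<Longrightarrow> \<mu> \<le> upper_const TYPE('v) * alpha_thr N s hi b"
proof -
  let ?h = "\<lambda>\<alpha>. infsum (weight N b \<alpha>) high" and ?\<delta> = "delta_c_high N s hi b"
    and ?\<alpha> = "alpha_thr N s hi b" and ?C = "upper_const TYPE('v)"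
  have \<alpha>: "?\<alpha> = ?\<delta> / slope" by (simp add: alpha_thr_def c'_high_conv)
  \<comment> \<open>With slope 0 the quotient would be 0 by the convention for division, against
    \<open>thr\<close>.\<close>
  then have slope: "0 < slope" using thr slope_nonneg by (cases "slope = 0") auto
  have \<delta>: "?\<delta> = ?\<alpha> * slope" using \<alpha> slope by simp
  with thr slope show \<delta>0: "0 < ?\<delta>" by simp
  have h0: "?h 0 = 1 + ?\<delta>" by (simp add: delta_c_high_conv(1))
  have l0: "0 \<le> infsum (weight N b \<mu>) low"
    using lam by (intro infsum_nonneg weight_nonneg walks) (auto simp: low_conv)
  have split: "?h \<mu> + infsum (weight N b \<mu>) low = 1"
    using split_all[OF weight_summable[OF less_imp_le[OF lam] order.refl]] return by simp
  show "?\<alpha> \<le> \<mu>"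
  proof (rule ccontr)
    assume "\<not> ?\<alpha> \<le> \<mu>"
    then have "\<mu> * slope < ?\<alpha> * slope" using slope by simp
    then show False using high_ge_tangent[of \<mu>] lam h0 \<delta> split l0 by simp
  qed
  assume small: "?C * ?\<alpha> \<le> b powi hi" and low: "low_const TYPE('v) * S_low N s hi b \<le> ?\<delta>"
  show "\<mu> \<le> ?C * ?\<alpha>"
  proof (rule ccontr)
    assume "\<not> \<mu> \<le> ?C * ?\<alpha>"
    then have lt: "?C * ?\<alpha> \<le> \<mu>" by simp
    have C0: "0 \<le> ?C * ?\<alpha>" using thr by (simp add: upper_const_def)
    have hs: "high \<subseteq> returns" by (auto simp: high_conv)
    \<comment> \<open>\<mu> itself is not known to lie below the high scales, so the decrease is
      evaluated at \<open>?C * ?\<alpha>\<close>, and monotonicity carries it over to \<mu>.\<close>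
    have "?h \<mu> \<le> ?h (?C * ?\<alpha>)"
      using lam C0 lt walks hs
      by (intro infsum_mono weight_summable[OF _ hs] weight_antimono) auto
    also have "\<dots> \<le> ?h 0 - ?C * ?\<alpha> * slope / (4 * (1 + 4 * real (short TYPE('v))))"
      by (rule high_decrease[OF C0 small])
    also have "?C * ?\<alpha> * slope / (4 * (1 + 4 * real (short TYPE('v)))) = 3 * ?\<delta>"
      unfolding \<delta> upper_const_def by (simp add: field_simps add_nonneg_eq_0_iff)
    finally have "?h \<mu> \<le> 1 - 2 * ?\<delta>" using h0 by simp
    moreover have "infsum (weight N b \<mu>) low \<le> ?\<delta>"
      using low_weight_le[of \<mu>] low lam by simp
    ultimately show False using split \<delta>0 by linarith
  qed
qed

text \<open>Adding the same positive rate to \<alpha> and \<beta> keeps their ratio below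
  \<open>C\<close>, so a walk loses at most one factor \<open>C\<close> per edge.\<close>

lemma weight_comparison:
  assumes \<alpha>: "0 < \<alpha>" "\<alpha> \<le> \<beta>" "\<beta> \<le> C * \<alpha>" "1 \<le> C" and w: "successively (edge N) \<gamma>"
  shows "weight N b \<beta> \<gamma> \<le> weight N b \<alpha> \<gamma>" "weight N b \<alpha> \<gamma> \<le> C ^ (length \<gamma> - 1) * weight N b \<beta> \<gamma>"
proof -
  show "weight N b \<beta> \<gamma> \<le> weight N b \<alpha> \<gamma>" using \<alpha> w by (intro weight_antimono) auto
  have "edge_weight N b \<alpha> \<sigma> \<tau> \<le> C * edge_weight N b \<beta> \<sigma> \<tau>" if "edge N \<sigma> \<tau>" for \<sigma> \<tau>
  proof -
    have k: "0 \<le> trans_rate N b \<sigma> \<tau>" using that trans_rate_nonneg[OF wf b] by (auto simp: edge_def)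
    have d: "0 < diag_rate N b \<sigma>" by (rule rates(1)[OF b])
    have "1 * diag_rate N b \<sigma> \<le> C * diag_rate N b \<sigma>" using d \<alpha>(4) by (intro mult_right_mono) auto
    then have "(diag_rate N b \<sigma> + \<beta>) / C \<le> diag_rate N b \<sigma> + \<alpha>"
      using \<alpha> by (simp add: pos_divide_le_eq algebra_simps)
    then have "trans_rate N b \<sigma> \<tau> / (diag_rate N b \<sigma> + \<alpha>) \<le> trans_rate N b \<sigma> \<tau> / ((diag_rate N b \<sigma> + \<beta>) / C)"
      using k d \<alpha> by (intro divide_left_mono mult_pos_pos divide_pos_pos) auto
    then show ?thesis by (simp add: edge_weight_def mult.commute)
  qed
  moreover have "0 \<le> edge_weight N b \<alpha> \<sigma> \<tau>" if "edge N \<sigma> \<tau>" for \<sigma> \<tau>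
    using small_loops.nonneg[OF weight_loops_nonneg that] \<alpha>(1) by simp
  ultimately have "walk_weight (edge_weight N b \<alpha>) \<gamma> \<le> walk_weight (\<lambda>\<sigma> \<tau>. C * edge_weight N b \<beta> \<sigma> \<tau>) \<gamma>"
    by (intro walk_weight_mono(2)[OF w])
  also have "\<dots> = C ^ (length \<gamma> - 1) * walk_weight (edge_weight N b \<beta>) \<gamma>"
    by (simp add: walk_weight_conv_prod prod.distrib)
  finally show "weight N b \<alpha> \<gamma> \<le> C ^ (length \<gamma> - 1) * weight N b \<beta> \<gamma>" by (simp add: weight_conv)
qed

lemma weight_le_power:
  assumes "0 \<le> \<alpha>" "successively (edge N) \<gamma>"
  shows "weight N b \<alpha> \<gamma> \<le> 4 ^ (length \<gamma> - 1)"
proof -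
  have "0 \<le> edge_weight N b \<alpha> \<sigma> \<tau> \<and> edge_weight N b \<alpha> \<sigma> \<tau> \<le> 4" if "edge N \<sigma> \<tau>" for \<sigma> \<tau>
  proof -
    have "- diag_rate N b \<upsilon> / 2 \<le> \<alpha>" for \<upsilon> using rates(1)[OF b, of \<upsilon>] assms(1) by linarith
    from edge_weight_le_majorant[OF b this that] majorant_bounds[OF b that] show ?thesis by linarith
  qed
  then have "walk_weight (edge_weight N b \<alpha>) \<gamma> \<le> walk_weight (\<lambda>_ _. 4) \<gamma>"
    by (intro walk_weight_mono(2)[OF assms(2)]) auto
  then show ?thesis by (simp add: weight_conv walk_weight_conv_prod)
qed

end

context irreducible_network
begin

lemma eventually_large_base:
  assumes "dominant_hypothesis N s"
  shows "\<forall>\<^sub>F b in at_top. large_base N s b"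
  using eventually_small_loops[OF assms] eventually_gt_at_top[of 1]
  by eventually_elim (intro large_base.intro large_base_axioms.intro irreducible_network_axioms)

lemma eventually_S_low_small:
  assumes dom: "dominant_hypothesis N s" and away: "away_from_transition N s hi"
    and pos: "\<forall>\<^sub>F b in at_top. 0 < delta_c_high N s hi b"
  shows "\<forall>\<^sub>F b in at_top. low_const TYPE('v) * S_low N s hi b \<le> delta_c_high N s hi b"
proof -
  let ?K = "low_const TYPE('v)" and ?l = "S_low N s hi" and ?h = "S_high N s hi"
  have K: "0 \<le> ?K" by (simp add: low_const_def)
  have \<delta>: "\<forall>\<^sub>F b in at_top. 0 \<le> ?l b \<and> delta_c_high N s hi b = ?h b - ?l b"
    using eventually_large_base[OF dom]
    by eventually_elim (simp add: large_base.S_low_nonneg large_base.delta_c_high_conv(2))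
  from away consider "?l \<prec> ?h" | "\<forall>\<^sub>F b in at_top. ?l b = 0" | "?h \<prec> ?l"
    unfolding away_from_transition_def by blast
  then show ?thesis
  proof cases
    case 1
    then have h: "\<forall>\<^sub>F b in at_top. 0 < ?h b" and l: "((\<lambda>b. ?l b / ?h b) \<longlongrightarrow> 0) at_top"
      by (auto simp: asymp_prec_def)
    \<comment> \<open>\<open>S_high\<close> must hold \<open>1 + ?K\<close> copies of
      \<open>S_low\<close>: one is subtracted in \<open>delta_c_high\<close>, and \<open>?K\<close>
      occur in the claim.\<close>
    have "0 < 1 / (1 + ?K)" using K by simp
    from h order_tendstoD(2)[OF l this] \<delta> show ?thesis
    proof eventually_elim
      case (elim b)
      then have "?l b * (1 + ?K) < ?h b" using K by (simp add: field_simps)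
      then show ?case using elim by (simp add: algebra_simps)
    qed
  next
    case 2
    with \<delta> pos show ?thesis by eventually_elim simp
  next
    \<comment> \<open>Here \<open>S_high\<close> eventually falls below \<open>S_low\<close>,
      contradicting the positivity of \<open>delta_c_high\<close>.\<close>
    case 3
    then have h: "\<forall>\<^sub>F b in at_top. 0 < ?l b" and l: "((\<lambda>b. ?h b / ?l b) \<longlongrightarrow> 0) at_top"
      by (auto simp: asymp_prec_def)
    from h order_tendstoD(2)[OF l zero_less_one] \<delta> pos show ?thesis
      by eventually_elim (simp add: pos_divide_less_eq)
  qed
qed

end

section \<open>Asymptotics of the Lyapunov weights\<close>

theorem lemma7p2:
  fixes N :: "('r, 'v::finite) network"
    and s :: 'v
    and lo :: "int option"
    and hi :: int
    and v :: "real \<Rightarrow> real ^ 'v"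
    and \<gamma> :: "'v \<Rightarrow> 'v list"
  assumes "wf_network N"
    and "CARD('v) \<ge> 2"
    and "strongly_connected N"
    and "\<forall>b>1. lyapunov_exponent N b > 0"
    and "dominant_hypothesis N s"
    and "scale_window N lo hi"
    and "window_contains lo hi (alpha_thr N s hi)"
    and "away_from_transition N s hi"
    and "\<forall>b>1. lyapunov_eigenvector N b (v b)"
    and "\<forall>b>1. (\<Sum>\<sigma>\<in>UNIV. lyapunov_weight N b (v b) \<sigma>) = 1"
    and "excursion N s s (\<gamma> s)" and "simple (\<gamma> s)" and "dominant N (\<gamma> s)"
    and "(\<lambda>b. weight N b (lyapunov_exponent N b) (\<gamma> s)) \<simeq> (\<lambda>b. 1)"
    and "\<forall>\<sigma>. \<sigma> \<noteq> s \<longrightarrow> leading N s \<sigma> (\<gamma> \<sigma>) \<and> simple (\<gamma> \<sigma>) \<and>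
           (\<lambda>b. excursion_sum N b (lyapunov_exponent N b) s \<sigma>) \<simeq>
           (\<lambda>b. weight N b (lyapunov_exponent N b) (\<gamma> \<sigma>))"
  shows "(\<forall>\<sigma>. (\<lambda>b. lyapunov_weight N b (v b) \<sigma>) \<simeq> (\<lambda>b. weight N b (alpha_thr N s hi b) (\<gamma> \<sigma>))) \<and>
         (\<lambda>b. lyapunov_weight N b (v b) s) \<simeq> (\<lambda>b. 1)"
proof -
  interpret irreducible_network N
    using assms(1-3) by unfold_locales
  let ?l = "lyapunov_exponent N" and ?\<alpha> = "alpha_thr N s hi" and ?C = "upper_const TYPE('v)"
    and ?\<pi> = "\<lambda>\<sigma> b. lyapunov_weight N b (v b) \<sigma>"
    and ?f = "\<lambda>\<sigma> b. excursion_sum N b (lyapunov_exponent N b) s \<sigma>"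
  have C1: "1 \<le> ?C" by (simp add: upper_const_def)
  have lam: "0 < ?l b" if "1 < b" for b using assms(4) that by blast
  have thr: "\<forall>\<^sub>F b in at_top. 0 < ?\<alpha> b" and prec: "?\<alpha> \<prec> (\<lambda>b. b powi hi)"
    using assms(7) by (auto simp: window_contains_def)
  have gt1: "\<forall>\<^sub>F b::real in at_top. 1 < b" by (rule eventually_gt_at_top)
  note large = eventually_large_base[OF assms(5)]
  have walk: "successively (edge N) (\<gamma> \<sigma>)" for \<sigma>
  proof -
    have "excursion N s \<sigma> (\<gamma> \<sigma>)"
      using assms(11,15) unfolding leading_def by (cases "\<sigma> = s") blast+
    then show ?thesis by (simp add: excursion_def is_path_def)
  qed
  have \<pi>f: "\<forall>\<^sub>F b in at_top. \<forall>\<sigma>. 0 < ?\<pi> s b \<and> ?\<pi> \<sigma> b = ?\<pi> s b * ?f \<sigma> b"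
    using large gt1
  proof eventually_elim
    case (elim b)
    interpret large_base N s b hi by (rule elim(1))
    have eig: "lyapunov_eigenvector N b (v b)" using assms(9) elim by blast
    show ?case
      by (intro allI conjI lyapunov_weight_invariant(1)[OF b lam[OF b] eig]
        lyapunov_excursion_sum[OF lam[OF b] eig])
  qed
  have return: "\<forall>\<^sub>F b in at_top. infsum (weight N b (?l b)) (excursions (edge N) s s) = 1"
    using \<pi>f
  proof eventually_elim
    case (elim b)
    from spec[OF this, of s] show ?case by (auto simp: excursion_sum_def excursion_conv)
  qed
  have bounds: "\<forall>\<^sub>F b in at_top. 0 < ?\<alpha> b \<and> ?\<alpha> b \<le> ?l b \<and> ?l b \<le> ?C * ?\<alpha> b"
  proof -
    have "\<forall>\<^sub>F b in at_top. 0 < delta_c_high N s hi b"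
      using large thr return gt1
      by eventually_elim (rule large_base.threshold_bounds(1)[OF _ _ lam])
    note low = eventually_S_low_small[OF assms(5,8) this]
    \<comment> \<open>The threshold is negligible against the high scale, and so is its multiple by
      \<open>?C\<close>.\<close>
    have "((\<lambda>b. ?\<alpha> b / b powi hi) \<longlongrightarrow> 0) at_top" using prec by (simp add: asymp_prec_def)
    from order_tendstoD(2)[OF this, of "1 / ?C"] C1
    have "\<forall>\<^sub>F b in at_top. ?\<alpha> b / b powi hi < 1 / ?C" by simp
    with large thr return gt1 low show ?thesis
    proof eventually_elim
      case (elim b)
      have "?C * ?\<alpha> b \<le> b powi hi" using elim C1 by (simp add: field_simps)
      then show ?case
        using large_base.threshold_bounds(2,3)[OF elim(1,2) lam[OF elim(4)] elim(3)] elim by blast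
    qed
  qed
  \<comment> \<open>The path stays fixed while \<open>b\<close> varies, so the factors lost per edge
    accumulate to a constant.\<close>
  have weights: "(\<lambda>b. weight N b (?l b) (\<gamma> \<sigma>)) \<simeq> (\<lambda>b. weight N b (?\<alpha> b) (\<gamma> \<sigma>))" for \<sigma>
  proof (rule asymp_simI)
    let ?D = "?C ^ (length (\<gamma> \<sigma>) - 1)"
    show D1: "1 \<le> ?D" using C1 by (rule one_le_power)
    show "\<forall>\<^sub>F b in at_top. weight N b (?l b) (\<gamma> \<sigma>) \<le> ?D * weight N b (?\<alpha> b) (\<gamma> \<sigma>) \<and>
        weight N b (?\<alpha> b) (\<gamma> \<sigma>) \<le> ?D * weight N b (?l b) (\<gamma> \<sigma>)"
      using large bounds
    proof eventually_elim
      case (elim b)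
      interpret large_base N s b hi by (rule elim(1))
      note c = weight_comparison[of "?\<alpha> b" "?l b" ?C, OF _ _ _ C1 walk]
      have "1 * weight N b (?\<alpha> b) (\<gamma> \<sigma>) \<le> ?D * weight N b (?\<alpha> b) (\<gamma> \<sigma>)"
        using elim by (intro mult_right_mono D1 weight_nonneg walk) auto
      with c[of \<sigma>] elim show ?case by simp
    qed
  qed
  have f: "?f \<sigma> \<simeq> (\<lambda>b. weight N b (?l b) (\<gamma> \<sigma>))" if "\<sigma> \<noteq> s" for \<sigma>
    using assms(15) that by blast
  \<comment> \<open>The excursion sum is comparable to the weight of one fixed path, whose edges
    weigh at most 4 each.\<close>
  have "\<exists>M. \<forall>\<^sub>F b in at_top. ?f \<sigma> b \<le> M" if ne: "\<sigma> \<noteq> s" for \<sigma>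
  proof -
    obtain D where D: "1 \<le> D" "\<forall>\<^sub>F b in at_top. ?f \<sigma> b \<le> D * weight N b (?l b) (\<gamma> \<sigma>) \<and>
        weight N b (?l b) (\<gamma> \<sigma>) \<le> D * ?f \<sigma> b"
      using f[OF ne] by (rule asymp_simE)
    have "\<forall>\<^sub>F b in at_top. ?f \<sigma> b \<le> D * 4 ^ (length (\<gamma> \<sigma>) - 1)"
      using D(2) large gt1
    proof eventually_elim
      case (elim b)
      have "weight N b (?l b) (\<gamma> \<sigma>) \<le> 4 ^ (length (\<gamma> \<sigma>) - 1)"
        using large_base.weight_le_power[OF elim(2) _ walk] lam[OF elim(3)] by simp
      then have "D * weight N b (?l b) (\<gamma> \<sigma>) \<le> D * 4 ^ (length (\<gamma> \<sigma>) - 1)"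
        using D(1) by (intro mult_left_mono) auto
      with elim(1) show ?case by linarith
    qed
    then show ?thesis by blast
  qed
  then obtain M where M: "\<And>\<sigma>. \<sigma> \<noteq> s \<Longrightarrow> \<forall>\<^sub>F b in at_top. ?f \<sigma> b \<le> M \<sigma>" by metis
  \<comment> \<open>By normalization, 1 is \<open>?\<pi> s b\<close> times one plus the excursion
    sums to the other vertices. These sums are bounded, so the mass at \<open>s\<close> stays away
    from 0.\<close>
  have \<pi>s: "?\<pi> s \<simeq> (\<lambda>b. 1)"
  proof (rule asymp_simI)
    let ?M = "1 + (\<Sum>\<sigma>\<in>UNIV - {s}. \<bar>M \<sigma>\<bar>)"
    show M1: "1 \<le> ?M" by (simp add: sum_nonneg)
    have "\<forall>\<^sub>F b in at_top. \<forall>\<sigma>\<in>UNIV - {s}. ?f \<sigma> b \<le> M \<sigma>"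
      by (rule eventually_ball_finite) (use M in auto)
    then show "\<forall>\<^sub>F b in at_top. ?\<pi> s b \<le> ?M * 1 \<and> 1 \<le> ?M * ?\<pi> s b"
      using \<pi>f gt1
    proof eventually_elim
      case (elim b)
      have pos: "0 < ?\<pi> s b" using elim(2) by blast
      have nonneg: "0 \<le> ?\<pi> \<sigma> b" for \<sigma>
        using lyapunov_weight_invariant(1)[OF elim(3) lam[OF elim(3)], of "v b" \<sigma>] assms(9) elim(3)
        by (simp add: less_imp_le)
      have sum: "1 = ?\<pi> s b + (\<Sum>\<sigma>\<in>UNIV - {s}. ?\<pi> \<sigma> b)"
        using assms(10) elim(3) sum.remove[of UNIV s "\<lambda>\<sigma>. ?\<pi> \<sigma> b"] by simp
      have "0 \<le> (\<Sum>\<sigma>\<in>UNIV - {s}. ?\<pi> \<sigma> b)" by (rule sum_nonneg) (rule nonneg)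
      with sum have "?\<pi> s b \<le> 1" by linarith
      with M1 have "?\<pi> s b \<le> ?M * 1" by (simp only: mult_1_right)
      moreover have "(\<Sum>\<sigma>\<in>UNIV - {s}. ?\<pi> \<sigma> b) \<le> (\<Sum>\<sigma>\<in>UNIV - {s}. ?\<pi> s b * \<bar>M \<sigma>\<bar>)"
      proof (rule sum_mono)
        fix \<sigma> assume "\<sigma> \<in> UNIV - {s}"
        then have "?f \<sigma> b \<le> \<bar>M \<sigma>\<bar>" using elim(1) by force
        then have "?\<pi> s b * ?f \<sigma> b \<le> ?\<pi> s b * \<bar>M \<sigma>\<bar>" using pos by simp
        then show "?\<pi> \<sigma> b \<le> ?\<pi> s b * \<bar>M \<sigma>\<bar>" using elim(2) by metis
      qed
      moreover have "?M * ?\<pi> s b = ?\<pi> s b + (\<Sum>\<sigma>\<in>UNIV - {s}. ?\<pi> s b * \<bar>M \<sigma>\<bar>)"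
        unfolding sum_distrib_left[symmetric] by (simp add: algebra_simps)
      ultimately show ?case using sum by (intro conjI) linarith+
    qed
  qed
  have "?\<pi> \<sigma> \<simeq> (\<lambda>b. weight N b (?\<alpha> b) (\<gamma> \<sigma>))" for \<sigma>
  proof (cases "\<sigma> = s")
    case True
    \<comment> \<open>At \<open>s\<close> both sides are comparable to 1, the path weight by
      hypothesis.\<close>
    have "?\<pi> s \<simeq> (\<lambda>b. weight N b (?l b) (\<gamma> s))"
      by (rule asymp_sim_trans[OF \<pi>s asymp_sim_sym[OF assms(14)]])
    from asymp_sim_trans[OF this weights] show ?thesis unfolding True .
  next
    case False
    have "?\<pi> \<sigma> \<simeq> (\<lambda>b. ?\<pi> s b * ?f \<sigma> b)"
    proof (rule asymp_simI[OF order.refl])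
      show "\<forall>\<^sub>F b in at_top. ?\<pi> \<sigma> b \<le> 1 * (?\<pi> s b * ?f \<sigma> b) \<and> ?\<pi> s b * ?f \<sigma> b \<le> 1 * ?\<pi> \<sigma> b"
        using \<pi>f
      proof eventually_elim
        case (elim b)
        from spec[OF this, of \<sigma>] show ?case by (simp only: mult_1_left order.refl simp_thms)
      qed
    qed
    also have "(\<lambda>b. ?\<pi> s b * ?f \<sigma> b) \<simeq> (\<lambda>b. weight N b (?l b) (\<gamma> \<sigma>))"
    proof (rule asymp_sim_mult_1[OF \<pi>s f[OF False]])
      show "\<forall>\<^sub>F b in at_top. 0 \<le> ?f \<sigma> b"
        using large gt1
        by eventually_elim (rule large_base.excursion_sum_nonneg, auto intro: less_imp_le lam)
    qed
    finally show ?thesis using weights by (rule asymp_sim_trans)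
  qed
  with \<pi>s show ?thesis by blast
qed

end
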